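(* Let $Y$ and $X$ be nonempty compact metric spaces, and let $R\subseteq Y\times X$ be a closed ideal incidence relation. If $\xi$ is a finite fractional cover on $X$, then there is a probability measure $\mathsf P$ on $\mathcal N_f(X)$ such that $\mathsf P$-almost every configuration covers $Y$ and $I_{\mathsf P}\le\xi$. In particular, the expected number of selected objects $\int\eta(X)\,d\mathsf P(\eta)$ is at most $\xi(X)$.
   Context: For $y\in Y$ put $R_y=\{x\in X:(y,x)\in R\}$. A finite fractional cover on $X$ is a finite positive Borel measure $\xi$ on $X$ with $\xi(R_y)\ge1$ for every $y\in Y$. The relation $R$ is ideal if for all finite families $y_1,\dots,y_n\in Y$ and $x_1,\dots,x_k\in X$, with incidence matrix $A_{ij}=1$ if $(y_i,x_j)\in R$ and $A_{ij}=0$ otherwise, every extreme point of the polyhedron $P(A)=\{z\in\mathbb R_{\ge0}^k: Az\ge\mathbf 1\}$ is integral. $\mathcal N_f(X)$ is the space of finite counting measures $\eta=\sum_{i=1}^m\delta_{x_i}$ on $X$ ($m\ge0$, $x_i\in X$), with the weak topology inherited from finite positive Borel measures on $X$ and the corresponding Borel $\sigma$-algebra; its elements are called configurations. A configuration $\eta$ covers $Y$ if $\eta(R_y)\ge1$ for every $y\in Y$. The intensity of a probability measure $\mathsf P$ on $\mathcal N_f(X)$ with finite mean mass is the measure $I_{\mathsf P}(A)=\int_{\mathcal N_f(X)}\eta(A)\,d\mathsf P(\eta)$, $A\subseteq X$ Borel (the evaluation maps $\eta\mapsto\eta(A)$ are Borel). $I_{\mathsf P}\le\xi$ means $I_{\mathsf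 P}(A)\le\xi(A)$ for all Borel $A\subseteq X$. *)

theory Defs
  imports "HOL-Probability.Probability" "HOL-Library.Function_Algebras"
begin

(* Vectors of varying length k are functions nat => real vanishing from k on. The pointwise
   vector space structure makes the library notion of extreme point available for them. *)
instantiation "fun" :: (type, real_vector) real_vector
begin

definition scaleR_fun :: "real \<Rightarrow> ('a \<Rightarrow> 'b) \<Rightarrow> 'a \<Rightarrow> 'b"
  where "scaleR_fun c f = (\<lambda>x. c *\<^sub>R f x)"

instance
  by standard (simp_all add: scaleR_fun_def fun_eq_iff scaleR_add_right scaleR_add_left)

end

definition cover_polyhedron :: "nat \<Rightarrow> nat \<Rightarrow> (nat \<Rightarrow> nat \<Rightarrow> real) \<Rightarrow> (nat \<Rightarrow> real) set"
  where "cover_polyhedron n k A =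
    {z. (\<forall>j<k. 0 \<le> z j) \<and> (\<forall>j\<ge>k. z j = 0) \<and> (\<forall>i<n. 1 \<le> (\<Sum>j<k. A i j * z j))}"

definition incidence_matrix ::
    "('y \<times> 'x) set \<Rightarrow> (nat \<Rightarrow> 'y) \<Rightarrow> (nat \<Rightarrow> 'x) \<Rightarrow> nat \<Rightarrow> nat \<Rightarrow> real"
  where "incidence_matrix R y x i j = (if (y i, x j) \<in> R then 1 else 0)"

(* Only y 0, ..., y (n-1) and x 0, ..., x (k-1) matter in the polyhedron. *)
definition ideal_relation :: "('y \<times> 'x) set \<Rightarrow> bool"
  where "ideal_relation R \<longleftrightarrow>
    (\<forall>n k y x z. z extreme_point_of cover_polyhedron n k (incidence_matrix R y x)
       \<longrightarrow> (\<forall>j<k. z j \<in> \<int>))"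

definition finite_borel_measures :: "'x::topological_space measure set"
  where "finite_borel_measures = {\<mu>. sets \<mu> = sets borel \<and> finite_measure \<mu>}"

definition fractional_cover :: "('y \<times> 'x) set \<Rightarrow> 'x::topological_space measure \<Rightarrow> bool"
  where "fractional_cover R \<xi> \<longleftrightarrow>
    \<xi> \<in> finite_borel_measures \<and> (\<forall>y. 1 \<le> emeasure \<xi> (R `` {y}))"

(* The initial topology on the finite Borel measures for the integrals of bounded continuous
   real functions. *)
definition weak_topology :: "'x::topological_space measure topology"
  where "weak_topology = topology_generated_by
    {{\<mu> \<in> finite_borel_measures. (LINT x|\<mu>. f x) \<in> U} | (f :: 'x \<Rightarrow> real) U.
       continuous_on UNIV f \<and> bounded (range f) \<and> open U}"

(* The measures given by a finite sum of Dirac measures, x 0, ..., x (m-1) with repetition. *)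
definition configurations :: "'x::topological_space measure set"
  where "configurations = {\<eta>. sets \<eta> = sets borel \<and>
    (\<exists>(m::nat) x. \<forall>A\<in>sets borel. emeasure \<eta> A = (\<Sum>i<m. emeasure (return borel (x i)) A))}"

definition configuration_topology :: "'x::topological_space measure topology"
  where "configuration_topology = subtopology weak_topology configurations"

definition configuration_space :: "'x::topological_space measure measure"
  where "configuration_space =
    sigma (topspace configuration_topology) {U. openin configuration_topology U}"

definition covers :: "('y \<times> 'x) set \<Rightarrow> 'x measure \<Rightarrow> bool"
  where "covers R \<eta> \<longleftrightarrow> (\<forall>y. 1 \<le> emeasure \<eta> (R `` {y}))"

definition intensity :: "'x measure measure \<Rightarrow> 'x set \<Rightarrow> ennreal"
  where "intensity P A = (\<integral>\<^sup>+ \<eta>. emeasure \<eta> A \<partial>P)"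

lemma topspace_weak_topology:
  "topspace (weak_topology :: 'x::topological_space measure topology) = finite_borel_measures"
proof -
  have "(finite_borel_measures :: 'x measure set)
      = {\<mu> \<in> finite_borel_measures. (LINT x|\<mu>. (0::real)) \<in> UNIV}"
    by simp
  moreover have "continuous_on UNIV (\<lambda>x::'x. 0::real)" "bounded (range (\<lambda>x::'x. 0::real))"
    by (auto intro: finite_imp_bounded)
  ultimately show ?thesis
    unfolding weak_topology_def topology_generated_by_topspace by blast
qed

lemma configurations_subset: "configurations \<subseteq> finite_borel_measures"
proof
  fix \<eta> :: "'a measure" assume "\<eta> \<in> configurations"
  then obtain m :: nat and x where s: "sets \<eta> = sets borel"
    and e: "\<And>A. A \<in> sets borel \<Longrightarrow> emeasure \<eta> A = (\<Sum>i<m. emeasure (return borel (x i)) A)"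
    unfolding configurations_def by blast
  have "space \<eta> = UNIV" using sets_eq_imp_space_eq[OF s] by simp
  then have "emeasure \<eta> (space \<eta>) = of_nat m" using e[of UNIV] by simp
  then have "finite_measure \<eta>" by (intro finite_measureI) simp
  with s show "\<eta> \<in> finite_borel_measures" by (simp add: finite_borel_measures_def)
qed

lemma space_configuration_space: "space configuration_space = configurations"
  using configurations_subset
  by (auto simp: configuration_space_def configuration_topology_def topspace_weak_topology
      space_measure_of_conv)

lemma sets_configuration_space:
  "sets configuration_space = sigma_sets configurations {U. openin configuration_topology U}"
proof -
  have t: "topspace configuration_topology = (configurations :: 'a measure set)"
    using configurations_subset
    by (auto simp: configuration_topology_def topspace_weak_topology)
  have "{U. openin configuration_topology U} \<subseteq> Pow (configurations :: 'a measure set)"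
    using openin_subset t by fastforce
  then show ?thesis by (simp add: configuration_space_def t sets_measure_of)
qed

end

theory Submission
  imports Defs
begin

text \<open>
Call a law of random configurations that covers finitely many \<open>y\<close> and has intensity close to
\<open>\<xi>\<close> an approximate rounding. The proof constructs approximate roundings by finite-dimensional
integrality and passes to a limit of laws.

For a finite \<open>F \<subseteq> Y\<close>, cut \<open>X\<close> into finitely many Borel cells of small diameter on each of which
membership in every section \<open>R\<^sub>y\<close>, \<open>y \<in> F\<close>, is constant, and choose a point of each cell. Giving
the chosen point the \<open>\<xi>\<close>-mass of its cell moves mass only within cells, so each \<open>R\<^sub>y\<close> keeps its mass
exactly (\<open>finite_discretisation\<close>): the vector of masses is a point of the covering polyhedron of an
incidence matrix of \<open>R\<close> itself. With cells that ignore the sections it would only cover with respect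
to a neighbourhood of \<open>R\<close>, which need not be ideal. A polyhedron whose recession cone lies in the
nonnegative orthant lies above the convex hull of its extreme points
(\<open>polyhedron_point_dominates_extreme_points\<close>), and here the extreme points are integral. Read as a
random choice of an extreme point, the convex combination is a finitely supported law of lists of
points that cover \<open>F\<close> and whose intensity is at most the discretised \<open>\<xi>\<close>
(\<open>approximate_rounding_exists\<close>).

Now let \<open>F\<close> run through an increasing sequence of finite sets with dense union and let the cells
shrink. The expected number of points stays below \<open>\<xi>(X)\<close>, so Markov's inequality makes the laws
tight. Weak compactness is reduced to Helly's theorem on the real line: finite lists of points of \<open>X\<close>
are coded by real numbers in such a way that the inverse of the coding is continuous and extends
continuously to the closure \<open>K\<close> of the codes (\<open>real_coding_of_lists_decoder\<close>). A weak limit of the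
coded laws lives on \<open>K\<close>, and its image under the decoder is a law on the configuration space
(\<open>configuration_laws_subsequential_limit\<close>).

Both required properties survive the limit. Integrals of continuous functions against the intensity are
at most those against \<open>\<xi>\<close>, hence so are the masses of open sets, and outer regularity of \<open>\<xi>\<close> gives
all Borel sets (\<open>intensity_le_of_integrals_le\<close>). Meeting a closed set is a closed condition on
configurations, so the limit law almost surely meets \<open>R\<^sub>y\<close> for every \<open>y\<close> in a countable dense set
(\<open>limit_law_meets_closed_set\<close>); since a configuration has finitely many points and \<open>R\<close> is closed, it then
covers every \<open>y\<close> (\<open>covers_configI\<close>).
\<close>

section \<open>Integral points of a covering polyhedron\<close>

text \<open>
Moving from a feasible point along a direction that does not disturb the tight constraints, stop at
the first constraint that becomes tight. The number of slack constraints then drops, which is the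
measure for the induction below. The stopping time is the least ratio of slack to speed.
\<close>

lemma ray_reaches_new_facet:
  fixes l :: "'c \<Rightarrow> 'v::real_vector \<Rightarrow> real"
  assumes C: "finite C" and lin: "\<And>c. c \<in> C \<Longrightarrow> linear (l c)"
    and feas: "\<And>c. c \<in> C \<Longrightarrow> r c \<le> l c z"
    and tight: "\<And>c. c \<in> C \<Longrightarrow> l c z = r c \<Longrightarrow> l c d = 0"
    and leaves: "\<exists>c\<in>C. l c d < 0"
  obtains t where "0 < t" "\<And>c. c \<in> C \<Longrightarrow> r c \<le> l c (z + t *\<^sub>R d)"
    "{c\<in>C. l c (z + t *\<^sub>R d) \<noteq> r c} \<subset> {c\<in>C. l c z \<noteq> r c}"
proof -
  define B where "B = {c\<in>C. l c d < 0}"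
  define h where "h c = (l c z - r c) / (- l c d)" for c
  have B: "finite B" "B \<noteq> {}" using C leaves by (auto simp: B_def)
  have lin': "l c (z + s *\<^sub>R d) = l c z + s * l c d" if "c \<in> C" for c s
    using lin[OF that] by (simp add: linear_add linear_scale)
  obtain c0 where c0: "c0 \<in> B" "\<And>c. c \<in> B \<Longrightarrow> h c0 \<le> h c"
    using B by (metis (no_types, lifting) arg_min_if_finite(1,2) linorder_not_less)
  let ?t = "h c0"
  have pos: "0 < ?t"
  proof -
    have "c0 \<in> C" "l c0 d < 0" using c0 by (auto simp: B_def)
    moreover have "r c0 < l c0 z" using feas[of c0] tight[of c0] calculation by force
    ultimately show ?thesis by (simp add: h_def divide_pos_neg field_simps)
  qed
  have le: "r c \<le> l c (z + ?t *\<^sub>R d)" if "c \<in> C" for c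
  proof (cases "l c d < 0")
    case True
    then have "?t \<le> h c" using c0(2) that by (simp add: B_def)
    then have "?t * (- l c d) \<le> h c * (- l c d)"
      using True by (intro mult_right_mono) auto
    also have "\<dots> = l c z - r c" using True by (simp add: h_def)
    finally show ?thesis using lin'[OF that] by simp
  next
    case False
    then show ?thesis using lin'[OF that] feas[OF that] pos
      by (simp add: add_increasing2)
  qed
  have c0C: "c0 \<in> C" "l c0 d < 0" using c0 by (auto simp: B_def)
  have "l c0 (z + ?t *\<^sub>R d) = r c0"
    using lin'[OF c0C(1), of ?t] c0C(2) by (simp add: h_def)
  moreover have "l c0 z \<noteq> r c0" using tight c0C by force
  moreover have "{c\<in>C. l c (z + ?t *\<^sub>R d) \<noteq> r c} \<subseteq> {c\<in>C. l c z \<noteq> r c}"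
    using tight lin' by auto
  ultimately have "{c\<in>C. l c (z + ?t *\<^sub>R d) \<noteq> r c} \<subset> {c\<in>C. l c z \<noteq> r c}"
    using c0C by blast
  then show ?thesis using that pos le by blast
qed

text \<open>
A point that is not extreme lies inside a segment of the polyhedron, and the direction of the segment
leaves all tight constraints tight. If neither this direction nor its opposite is nonnegative, the
recession hypothesis lets one move both ways until a new constraint is tight, and the point is a convex
combination of the two end points. If one of them is nonnegative, then one moves along the other and
arrives at a smaller point. In both cases the end points have fewer slack constraints.
\<close>

lemma polyhedron_point_dominates_extreme_points:
  fixes l :: "'c \<Rightarrow> ('a \<Rightarrow> real) \<Rightarrow> real"
  assumes C: "finite C" and lin: "\<And>c. c \<in> C \<Longrightarrow> linear (l c)"
    and V: "subspace V"
    and recession: "\<And>d. d \<in> V \<Longrightarrow> \<not> (\<forall>j. 0 \<le> d j) \<Longrightarrow> \<exists>c\<in>C. l c d < 0"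
    and P: "P = {z\<in>V. \<forall>c\<in>C. r c \<le> l c z}"
    and z: "z \<in> P"
  shows "\<exists>w \<in> convex hull {v. v extreme_point_of P}. \<forall>j. w j \<le> z j"
  using z
proof (induction "card {c\<in>C. l c z \<noteq> r c}" arbitrary: z rule: less_induct)
  case less
  let ?H = "convex hull {v. v extreme_point_of P}"
  show ?case
  proof (cases "z extreme_point_of P")
    case True
    then have "z \<in> ?H" by (simp add: hull_inc)
    then show ?thesis by blast
  next
    case False
    then obtain a b where ab: "a \<in> P" "b \<in> P" "z \<in> open_segment a b"
      using less.prems by (auto simp: extreme_point_of_def)
    then obtain u where u: "0 < u" "u < 1" "z = (1 - u) *\<^sub>R a + u *\<^sub>R b" "a \<noteq> b"
      by (auto simp: in_segment)
    define d where "d = b - a"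
    have dV: "d \<in> V" "- d \<in> V" and d0: "d \<noteq> 0"
      using ab u V by (auto simp: P d_def subspace_diff)
    have feas: "\<And>c. c \<in> C \<Longrightarrow> r c \<le> l c z" and zV: "z \<in> V"
      using less.prems by (auto simp: P)
    have tight: "l c d = 0" if c: "c \<in> C" "l c z = r c" for c
    proof -
      have e: "r c = (1 - u) * l c a + u * l c b"
        using u(3) c(2) lin[OF c(1)] by (simp add: linear_add linear_scale)
      have le: "r c \<le> l c a" "r c \<le> l c b" using ab c(1) by (auto simp: P)
      have "(1 - u) * (l c a - r c) + u * (l c b - r c) = 0"
        using e by (simp add: algebra_simps)
      moreover have "0 \<le> (1 - u) * (l c a - r c)" "0 \<le> u * (l c b - r c)"
        using u le by auto
      ultimately have "(1 - u) * (l c a - r c) = 0" "u * (l c b - r c) = 0" by linarith+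
      then show ?thesis using u lin[OF c(1)] by (simp add: d_def linear_diff)
    qed
    have move: "\<exists>t>0. \<exists>w\<in>?H. \<forall>j. w j \<le> (z + t *\<^sub>R e) j"
      if e: "e \<in> V" "\<And>c. c \<in> C \<Longrightarrow> l c z = r c \<Longrightarrow> l c e = 0" "\<not> (\<forall>j. 0 \<le> e j)" for e
    proof -
      obtain t where t: "0 < t" "\<And>c. c \<in> C \<Longrightarrow> r c \<le> l c (z + t *\<^sub>R e)"
        "{c\<in>C. l c (z + t *\<^sub>R e) \<noteq> r c} \<subset> {c\<in>C. l c z \<noteq> r c}"
        using ray_reaches_new_facet[of C l r z e, OF C lin feas e(2) recession[OF e(1,3)]]
        by blast
      have "z + t *\<^sub>R e \<in> P"
        using t(2) zV e(1) V by (auto simp: P subspace_add subspace_scale)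
      moreover have "card {c\<in>C. l c (z + t *\<^sub>R e) \<noteq> r c} < card {c\<in>C. l c z \<noteq> r c}"
        using t(3) C by (intro psubset_card_mono) auto
      ultimately show ?thesis using less.hyps t(1) by blast
    qed
    have tight': "\<And>c. c \<in> C \<Longrightarrow> l c z = r c \<Longrightarrow> l c (- d) = 0"
      using tight lin by (simp add: linear_neg)
    \<comment> \<open>In the first two cases one ray may stay in the polyhedron forever; the opposite one does not.\<close>
    consider "\<forall>j. 0 \<le> d j" | "\<forall>j. 0 \<le> (- d) j"
      | "\<not> (\<forall>j. 0 \<le> d j)" "\<not> (\<forall>j. 0 \<le> (- d) j)" by blast
    then show ?thesis
    proof cases
      case 1
      have "\<not> (\<forall>j. 0 \<le> (- d) j)"
      proof
        assume "\<forall>j. 0 \<le> (- d) j"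
        then have "d = 0" using 1 by (auto simp: fun_eq_iff intro: antisym)
        then show False using d0 by simp
      qed
      then obtain t w where tw: "0 < t" "w \<in> ?H" "\<And>j. w j \<le> (z + t *\<^sub>R (- d)) j"
        using move[OF dV(2) tight'] by blast
      have "w j \<le> z j" for j
      proof -
        have "0 \<le> t * d j" using 1 tw(1) by simp
        then show ?thesis using tw(3)[of j] by (simp add: scaleR_fun_def)
      qed
      then show ?thesis using tw(2) by blast
    next
      case 2
      have "\<not> (\<forall>j. 0 \<le> d j)"
      proof
        assume "\<forall>j. 0 \<le> d j"
        then have "d = 0" using 2 by (auto simp: fun_eq_iff intro: antisym)
        then show False using d0 by simp
      qed
      then obtain t w where tw: "0 < t" "w \<in> ?H" "\<And>j. w j \<le> (z + t *\<^sub>R d) j"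
        using move[OF dV(1) tight] by blast
      have "w j \<le> z j" for j
      proof -
        have "0 \<le> t * (- d) j" using 2 tw(1) by (simp only: zero_le_mult_iff) auto
        then show ?thesis using tw(3)[of j] by (simp add: scaleR_fun_def)
      qed
      then show ?thesis using tw(2) by blast
    next
      case 3
      obtain t w where tw: "0 < t" "w \<in> ?H" "\<And>j. w j \<le> (z + t *\<^sub>R d) j"
        using move[OF dV(1) tight 3(1)] by blast
      obtain s v where sv: "0 < s" "v \<in> ?H" "\<And>j. v j \<le> (z + s *\<^sub>R (- d)) j"
        using move[OF dV(2) tight' 3(2)] by blast
      let ?x = "(s / (s + t)) *\<^sub>R w + (t / (s + t)) *\<^sub>R v"
      have "?x \<in> ?H"
        using tw sv by (intro convexD[OF convex_convex_hull]) (auto simp: add_divide_distrib[symmetric])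
      moreover have "?x j \<le> z j" for j
      proof -
        have "(s / (s + t)) * w j \<le> (s / (s + t)) * (z j + t * d j)"
          using tw(3)[of j] tw(1) sv(1) by (intro mult_left_mono) (auto simp: scaleR_fun_def)
        moreover have "(t / (s + t)) * v j \<le> (t / (s + t)) * (z j - s * d j)"
          using sv(3)[of j] tw(1) sv(1) by (intro mult_left_mono) (auto simp: scaleR_fun_def)
        ultimately have "?x j \<le> (s / (s + t)) * (z j + t * d j) + (t / (s + t)) * (z j - s * d j)"
          by (simp add: scaleR_fun_def)
        also have "\<dots> = (s + t) * z j / (s + t)"
          by (simp add: add_divide_distrib[symmetric] algebra_simps)
        also have "\<dots> = z j" using tw(1) sv(1) by simp
        finally show ?thesis .
      qed
      ultimately show ?thesis by blast
    qed
  qed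
qed

text \<open>
The constraints \<open>0 \<le> z j\<close> and \<open>1 \<le> (A z) i\<close> are indexed by a disjoint sum. The equations
\<open>z j = 0\<close> for \<open>j \<ge> k\<close> go into the subspace, since there are infinitely many of them. A direction of the
subspace with a negative entry violates one of the constraints \<open>0 \<le> z j\<close> in the end.
\<close>

lemma cover_polyhedron_point_dominates_extreme_points:
  assumes z: "z \<in> cover_polyhedron n k A"
  shows "\<exists>w \<in> convex hull {v. v extreme_point_of cover_polyhedron n k A}. \<forall>j. w j \<le> z j"
proof -
  let ?C = "{..<k} <+> {..<n}"
  let ?l = "\<lambda>c (z :: nat \<Rightarrow> real). case c of Inl j \<Rightarrow> z j | Inr i \<Rightarrow> (\<Sum>j<k. A i j * z j)"
  let ?r = "\<lambda>c. case c of Inl j \<Rightarrow> 0 | Inr i \<Rightarrow> (1 :: real)"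
  let ?V = "{z :: nat \<Rightarrow> real. \<forall>j\<ge>k. z j = 0}"
  show ?thesis
  proof (rule polyhedron_point_dominates_extreme_points[where C = ?C and l = ?l and r = ?r
        and V = ?V, OF _ _ _ _ _ z])
    show "finite ?C" by simp
    show "linear (?l c)" if "c \<in> ?C" for c
      by (cases c; rule linearI)
        (simp_all add: scaleR_fun_def sum.distrib sum_distrib_left algebra_simps)
    show "subspace ?V" by (simp add: subspace_def scaleR_fun_def)
    show "\<exists>c\<in>?C. ?l c d < 0" if d: "d \<in> ?V" "\<not> (\<forall>j. 0 \<le> d j)" for d
    proof -
      obtain j where "d j < 0" using d(2) by (auto simp: not_le)
      moreover from this d(1) have "j < k" by (metis (mono_tags, lifting) linorder_not_le mem_Collect_eq order_less_irrefl)
      ultimately show ?thesis by (intro bexI[of _ "Inl j"]) auto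
    qed
    show "cover_polyhedron n k A = {z \<in> ?V. \<forall>c\<in>?C. ?r c \<le> ?l c z}"
      by (auto simp: cover_polyhedron_def Plus_def ball_Un)
  qed
qed

lemma pmf_of_weights:
  assumes "finite S" "\<And>v. v \<in> S \<Longrightarrow> 0 \<le> u v" "sum u S = (1 :: real)"
  obtains p where "set_pmf p \<subseteq> S" "\<And>v. v \<in> S \<Longrightarrow> pmf p v = u v"
proof -
  let ?f = "\<lambda>v. if v \<in> S then u v else 0"
  have "(\<integral>\<^sup>+ v. ennreal (?f v) \<partial>count_space UNIV) = (\<Sum>v\<in>S. ennreal (u v))"
    using assms(1) by (subst nn_integral_count_space'[where A = S]) auto
  also have "\<dots> = ennreal (sum u S)" using assms(2) by (rule sum_ennreal)
  finally have one: "(\<integral>\<^sup>+ v. ennreal (?f v) \<partial>count_space UNIV) = 1" using assms(3) by simp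
  have f: "pmf (embed_pmf ?f) v = ?f v" for v
    using assms(2) one by (intro pmf_embed_pmf) auto
  show ?thesis
    by (rule that[of "embed_pmf ?f"]) (auto simp: f set_pmf_iff split: if_splits)
qed

text \<open>
An integral point \<open>v\<close> of the covering polyhedron, read as the configuration in which the point \<open>x j\<close>
occurs \<open>v j\<close> times.
\<close>

definition list_with_multiplicities :: "nat \<Rightarrow> (nat \<Rightarrow> 'a) \<Rightarrow> (nat \<Rightarrow> real) \<Rightarrow> 'a list"
  where "list_with_multiplicities k x v = concat (map (\<lambda>j. replicate (nat \<lfloor>v j\<rfloor>) (x j)) [0..<k])"

lemma sum_list_with_multiplicities:
  fixes f :: "'a \<Rightarrow> real"
  assumes "\<And>j. j < k \<Longrightarrow> v j \<in> \<int>" "\<And>j. j < k \<Longrightarrow> 0 \<le> v j"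
  shows "sum_list (map f (list_with_multiplicities k x v)) = (\<Sum>j<k. v j * f (x j))"
proof -
  have "sum_list (map f (list_with_multiplicities k x v)) = (\<Sum>j<k. real (nat \<lfloor>v j\<rfloor>) * f (x j))"
    unfolding list_with_multiplicities_def
    by (induction k) (simp_all add: sum_list_replicate)
  also have "\<dots> = (\<Sum>j<k. v j * f (x j))"
  proof (rule sum.cong)
    fix j assume "j \<in> {..<k}"
    then have "v j \<in> \<int>" "0 \<le> v j" using assms by auto
    then have "real (nat \<lfloor>v j\<rfloor>) = v j" by (auto elim!: Ints_cases)
    then show "real (nat \<lfloor>v j\<rfloor>) * f (x j) = v j * f (x j)" by simp
  qed simp
  finally show ?thesis .
qed

lemma set_list_with_multiplicities:
  "set (list_with_multiplicities k x v) = x ` {j. j < k \<and> 1 \<le> v j}"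
proof -
  have "set (list_with_multiplicities k x v) = (\<Union>j\<in>{0..<k}. if nat \<lfloor>v j\<rfloor> = 0 then {} else {x j})"
    by (auto simp: list_with_multiplicities_def)
  also have "\<dots> = x ` {j. j < k \<and> 1 \<le> v j}"
    by (auto split: if_splits simp: le_floor_iff not_le)
  finally show ?thesis .
qed

text \<open>
The random list is \<open>list_with_multiplicities\<close> of a random extreme point, drawn with the weights of a
convex combination of extreme points below \<open>z\<close>. Integrality is used twice: multiplicities are then exact,
and a row of the incidence matrix with value at least 1 contains a positive entry, which is at least 1.
\<close>

lemma ideal_relation_rounding:
  fixes y :: "nat \<Rightarrow> 'y" and x :: "nat \<Rightarrow> 'x"
  assumes ideal: "ideal_relation R" and z: "z \<in> cover_polyhedron n k (incidence_matrix R y x)"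
  obtains p :: "'x list pmf" where "finite (set_pmf p)"
    "\<And>xs i. xs \<in> set_pmf p \<Longrightarrow> i < n \<Longrightarrow> \<exists>a\<in>set xs. (y i, a) \<in> R"
    "\<And>f. (\<And>a. 0 \<le> f a) \<Longrightarrow>
       measure_pmf.expectation p (\<lambda>xs. sum_list (map f xs)) \<le> (\<Sum>j<k. z j * f (x j))"
proof -
  let ?P = "cover_polyhedron n k (incidence_matrix R y x)"
  obtain w where w: "w \<in> convex hull {v. v extreme_point_of ?P}" "\<And>j. w j \<le> z j"
    using cover_polyhedron_point_dominates_extreme_points[OF z] by blast
  obtain S u where S: "finite S" "S \<subseteq> {v. v extreme_point_of ?P}"
    and u: "\<And>v. v \<in> S \<Longrightarrow> 0 \<le> u v" "sum u S = 1" and wsum: "(\<Sum>v\<in>S. u v *\<^sub>R v) = w"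
    using w(1) unfolding convex_hull_explicit by blast
  have "(\<Sum>v\<in>S. u v *\<^sub>R v) j = (\<Sum>v\<in>S. u v * v j)" for j
    using S(1) by (induction S) (simp_all add: scaleR_fun_def)
  then have wj: "w j = (\<Sum>v\<in>S. u v * v j)" for j using wsum by simp
  have int: "v j \<in> \<int>" if "v \<in> S" "j < k" for v j
    using ideal S(2) that unfolding ideal_relation_def by blast
  have P: "v \<in> ?P" if "v \<in> S" for v
    using S(2) that by (auto simp: extreme_point_of_def)
  have nonneg: "0 \<le> v j" if "v \<in> S" "j < k" for v j
    using P[OF that(1)] that(2) by (simp add: cover_polyhedron_def)
  obtain q where q: "set_pmf q \<subseteq> S" "\<And>v. v \<in> S \<Longrightarrow> pmf q v = u v"
    using pmf_of_weights[of S u] S(1) u by blast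
  let ?L = "list_with_multiplicities k x"
  show ?thesis
  proof (rule that[of "map_pmf ?L q"])
    show "finite (set_pmf (map_pmf ?L q))"
      using finite_subset[OF q(1) S(1)] by simp
    show "\<exists>a\<in>set xs. (y i, a) \<in> R" if xs: "xs \<in> set_pmf (map_pmf ?L q)" and i: "i < n" for xs i
    proof -
      obtain v where v: "v \<in> S" "xs = ?L v" using xs q(1) by auto
      have "1 \<le> (\<Sum>j<k. incidence_matrix R y x i j * v j)"
        using P[OF v(1)] i by (simp add: cover_polyhedron_def)
      then have "(\<Sum>j<k. incidence_matrix R y x i j * v j) \<noteq> 0" by linarith
      then obtain j where j: "j < k" "incidence_matrix R y x i j * v j \<noteq> 0"
        by (metis (no_types, lifting) lessThan_iff sum.not_neutral_contains_not_neutral)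
      then have "(y i, x j) \<in> R" "v j \<noteq> 0"
        by (auto simp: incidence_matrix_def split: if_splits)
      moreover have "1 \<le> v j"
        using int[OF v(1) j(1)] nonneg[OF v(1) j(1)] \<open>v j \<noteq> 0\<close> by (auto elim!: Ints_cases)
      ultimately show ?thesis using j(1) v(2) by (auto simp: set_list_with_multiplicities)
    qed
    show "measure_pmf.expectation (map_pmf ?L q) (\<lambda>xs. sum_list (map f xs)) \<le> (\<Sum>j<k. z j * f (x j))"
      if f: "\<And>a. 0 \<le> f a" for f
    proof -
      have "measure_pmf.expectation (map_pmf ?L q) (\<lambda>xs. sum_list (map f xs))
          = (\<Sum>v\<in>S. sum_list (map f (?L v)) * pmf q v)"
        using S(1) q(1) by (simp add: integral_measure_pmf_real[where A = S] subset_iff)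
      also have "\<dots> = (\<Sum>v\<in>S. \<Sum>j<k. u v * v j * f (x j))"
        using int nonneg q(2)
        by (intro sum.cong) (simp_all add: sum_list_with_multiplicities sum_distrib_left mult_ac)
      also have "\<dots> = (\<Sum>j<k. w j * f (x j))"
        by (subst sum.swap) (simp add: wj sum_distrib_right)
      also have "\<dots> \<le> (\<Sum>j<k. z j * f (x j))"
        using w(2) f by (intro sum_mono mult_right_mono) auto
      finally show ?thesis .
    qed
  qed
qed

section \<open>Finitely supported laws that cover finitely many points\<close>

lemma finite_net:
  assumes "compact (UNIV :: 'x::metric_space set)" and "0 < e"
  obtains T :: "'x::metric_space list" where "\<And>x. \<exists>i<length T. dist (T ! i) x < e"
proof -
  have "(UNIV :: 'x set) \<subseteq> (\<Union>c\<in>UNIV. ball c e)" using assms(2) by auto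
  from compactE_image[OF assms(1) _ this]
  obtain S :: "'x set" where S: "finite S" "UNIV \<subseteq> (\<Union>c\<in>S. ball c e)"
    by (metis open_ball)
  obtain T where T: "set T = S" using finite_list[OF S(1)] by blast
  have "\<exists>i<length T. dist (T ! i) x < e" for x
  proof -
    obtain c where "c \<in> S" "dist c x < e" using S(2) by (auto simp: subset_iff)
    then show ?thesis by (metis T in_set_conv_nth)
  qed
  then show ?thesis by (rule that)
qed

text \<open>
The cells are the atoms of the finite algebra generated by \<open>\<B>\<close> and the balls of radius \<open>e/2\<close>
around a finite net, so each of them has diameter at most \<open>e\<close> and lies inside or outside each \<open>B \<in> \<B>\<close>.
Each \<open>x j\<close> represents one cell and \<open>z j\<close> is the mass of that cell.
\<close>

lemma finite_discretisation:
  fixes \<xi> :: "'x::metric_space measure"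
  assumes comp: "compact (UNIV :: 'x set)" and \<xi>: "finite_measure \<xi>" "sets \<xi> = sets borel"
    and B: "finite \<B>" "\<And>B. B \<in> \<B> \<Longrightarrow> B \<in> sets borel" and e: "0 < e"
  obtains k and x :: "nat \<Rightarrow> 'x" and z :: "nat \<Rightarrow> real"
  where "\<And>j. 0 \<le> z j" "\<And>j. k \<le> j \<Longrightarrow> z j = 0"
    "\<And>B. B \<in> \<B> \<Longrightarrow> (\<Sum>j<k. of_bool (x j \<in> B) * z j) = measure \<xi> B"
    "\<And>f w. continuous_on UNIV f \<Longrightarrow> (\<And>a b. dist a b < e \<Longrightarrow> \<bar>f a - f b\<bar> \<le> w) \<Longrightarrow>
      (\<Sum>j<k. z j * f (x j)) \<le> (LINT a|\<xi>. f a) + w * measure \<xi> UNIV"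
proof -
  interpret finite_measure \<xi> by fact
  have space: "space \<xi> = UNIV" using sets_eq_imp_space_eq[OF \<xi>(2)] by simp
  obtain T :: "'x list" where T: "\<And>a. \<exists>i<length T. dist (T ! i) a < e/2"
    using finite_net[OF comp, of "e/2"] e by auto
  \<comment> \<open>With the whole space in the family, a cell is an intersection over a nonempty index set.\<close>
  define G where "G = insert UNIV (\<B> \<union> (\<lambda>c. ball c (e/2)) ` set T)"
  have G: "finite G" "\<And>B. B \<in> G \<Longrightarrow> B \<in> sets borel"
    using B by (auto simp: G_def)
  define \<kappa> where "\<kappa> a = {B\<in>G. a \<in> B}" for a
  define I where "I = range \<kappa>"
  have I: "finite I"
    using G(1) by (intro finite_subset[of I "Pow G"]) (auto simp: I_def \<kappa>_def)
  define cell where "cell S = {a. \<kappa> a = S}" for S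
  have cell: "cell S \<in> sets borel" for S
  proof (cases "S \<subseteq> G")
    case True
    have "cell S = (\<Inter>B\<in>G. if B \<in> S then B else - B)"
      using True by (auto simp: cell_def \<kappa>_def)
    also have "\<dots> \<in> sets borel"
      using G by (intro sets.finite_INT) (auto simp: G_def)
    finally show ?thesis .
  next
    case False
    then have "cell S = {}" by (auto simp: cell_def \<kappa>_def)
    then show ?thesis by simp
  qed
  define m where "m S = measure \<xi> (cell S)" for S
  have m: "measure \<xi> (\<Union>S\<in>J. cell S) = sum m J" if "J \<subseteq> I" for J
    unfolding m_def using that I cell \<xi>(2) finite_subset
    by (intro finite_measure_finite_Union) (auto simp: disjoint_family_on_def cell_def)
  obtain g where g: "bij_betw g {0..<card I} I" using ex_bij_betw_nat_finite[OF I] by blast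
  define r where "r S = (SOME a. \<kappa> a = S)" for S
  have r: "\<kappa> (r S) = S" if "S \<in> I" for S
  proof -
    have "\<exists>a. \<kappa> a = S" using that by (auto simp: I_def)
    then show ?thesis unfolding r_def by (rule someI_ex)
  qed
  define x where "x j = r (g j)" for j
  define z where "z j = (if j < card I then m (g j) else 0)" for j
  have reindex: "(\<Sum>j<card I. h (x j) (z j)) = (\<Sum>S\<in>I. h (r S) (m S))"
    for h :: "'x \<Rightarrow> real \<Rightarrow> real"
    using sum.reindex_bij_betw[OF g, of "\<lambda>S. h (r S) (m S)"]
    by (simp add: x_def z_def atLeast0LessThan)
  show ?thesis
  proof (rule that[of z "card I" x])
    show "0 \<le> z j" for j by (simp add: z_def m_def)
    show "z j = 0" if "card I \<le> j" for j using that by (simp add: z_def)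
    show "(\<Sum>j<card I. of_bool (x j \<in> B) * z j) = measure \<xi> B" if "B \<in> \<B>" for B
    proof -
      have BG: "B \<in> G" using that by (simp add: G_def)
      have "(\<Sum>j<card I. of_bool (x j \<in> B) * z j) = (\<Sum>S\<in>I. of_bool (r S \<in> B) * m S)"
        by (rule reindex)
      also have "\<dots> = (\<Sum>S\<in>I. if B \<in> S then m S else 0)"
      proof (rule sum.cong)
        fix S assume "S \<in> I"
        then have "r S \<in> B \<longleftrightarrow> B \<in> S" using r BG by (metis (mono_tags, lifting) \<kappa>_def mem_Collect_eq)
        then show "of_bool (r S \<in> B) * m S = (if B \<in> S then m S else 0)" by simp
      qed simp
      also have "\<dots> = sum m {S\<in>I. B \<in> S}" using I by (simp add: sum.inter_filter)
      also have "\<dots> = measure \<xi> (\<Union>S\<in>{S\<in>I. B \<in> S}. cell S)" by (intro m[symmetric]) auto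
      also have "(\<Union>S\<in>{S\<in>I. B \<in> S}. cell S) = B"
        using BG by (auto simp: cell_def I_def \<kappa>_def)
      finally show ?thesis .
    qed
    show "(\<Sum>j<card I. z j * f (x j)) \<le> (LINT a|\<xi>. f a) + w * measure \<xi> UNIV"
      if f: "continuous_on UNIV f" and w: "\<And>a b. dist a b < e \<Longrightarrow> \<bar>f a - f b\<bar> \<le> w" for f w
    proof -
      have close: "\<bar>f (r S) - f a\<bar> \<le> w" if "a \<in> cell S" "S \<in> I" for a S
      proof -
        obtain i where i: "i < length T" "dist (T ! i) a < e/2" using T by blast
        have "ball (T ! i) (e/2) \<in> \<kappa> a" using i by (auto simp: \<kappa>_def G_def)
        then have "ball (T ! i) (e/2) \<in> \<kappa> (r S)" using that r by (simp add: cell_def)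
        then have "dist (T ! i) (r S) < e/2" by (simp add: \<kappa>_def)
        then have "dist (r S) a < e"
          using i(2) dist_triangle3[of "r S" a "T ! i"] by (simp add: dist_commute)
        then show ?thesis by (rule w)
      qed
      have f_meas: "f \<in> borel_measurable \<xi>"
        using borel_measurable_continuous_onI[OF f] by (simp cong: measurable_cong_sets add: \<xi>(2))
      obtain M where M: "\<And>a. norm (f a) \<le> M"
        using compact_continuous_image[OF f comp] compact_imp_bounded
        by (metis bounded_iff rangeI)
      have f_int: "integrable \<xi> f"
        by (rule integrable_const_bound[of _ M]) (use M f_meas in auto)
      have ind_int: "integrable \<xi> (\<lambda>a. (f (r S) - w) * indicator (cell S) a)" for S
        using cell \<xi>(2) by (intro integrable_mult_right integrable_real_indicator)
          (simp_all add: less_top[symmetric])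
      have "(\<Sum>S\<in>I. (f (r S) - w) * m S) = (LINT a|\<xi>. (\<Sum>S\<in>I. (f (r S) - w) * indicator (cell S) a))"
        using cell \<xi>(2) space by (subst Bochner_Integration.integral_sum[OF ind_int]) (simp add: m_def)
      also have "\<dots> \<le> (LINT a|\<xi>. f a)"
      proof (rule integral_mono)
        show "integrable \<xi> (\<lambda>a. \<Sum>S\<in>I. (f (r S) - w) * indicator (cell S) a)"
          by (intro Bochner_Integration.integrable_sum ind_int)
        show "(\<Sum>S\<in>I. (f (r S) - w) * indicator (cell S) a) \<le> f a" for a
        proof -
          have "(\<Sum>S\<in>I. (f (r S) - w) * indicator (cell S) a) = (\<Sum>S\<in>I. if S = \<kappa> a then f (r S) - w else 0)"
            by (intro sum.cong) (auto simp: cell_def indicator_def)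
          also have "\<dots> = f (r (\<kappa> a)) - w" using I by (simp add: I_def)
          also have "\<dots> \<le> f a" using close[of a "\<kappa> a"] by (simp add: cell_def I_def abs_le_iff)
          finally show ?thesis .
        qed
      qed (fact f_int)
      finally have "(\<Sum>S\<in>I. m S * f (r S)) \<le> (LINT a|\<xi>. f a) + w * sum m I"
        by (simp add: algebra_simps sum_subtractf sum_distrib_left)
      moreover have "sum m I = measure \<xi> UNIV"
      proof -
        have "(\<Union>S\<in>I. cell S) = UNIV" by (auto simp: cell_def I_def)
        then show ?thesis using m[of I] by simp
      qed
      moreover have "(\<Sum>j<card I. z j * f (x j)) = (\<Sum>S\<in>I. m S * f (r S))"
        by (rule reindex[of "\<lambda>a t. t * f a"])
      ultimately show ?thesis by simp
    qed
  qed
qed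

text \<open>
The last clause says that the intensity of the law is below \<open>\<xi>\<close> up to transport over distances
less than \<open>e\<close>; \<open>w\<close> is the oscillation of the test function at that scale.
\<close>

definition approximate_rounding ::
    "('y \<times> 'x::metric_space) set \<Rightarrow> 'x measure \<Rightarrow> 'y set \<Rightarrow> real \<Rightarrow> 'x list pmf \<Rightarrow> bool"
  where "approximate_rounding R \<xi> F e p \<longleftrightarrow>
    finite (set_pmf p) \<and>
    (\<forall>xs\<in>set_pmf p. \<forall>y\<in>F. \<exists>a\<in>set xs. (y, a) \<in> R) \<and>
    (\<forall>f w. continuous_on UNIV f \<longrightarrow> (\<forall>a. 0 \<le> f a) \<longrightarrow>
      (\<forall>a b. dist a b < e \<longrightarrow> \<bar>f a - f b\<bar> \<le> w) \<longrightarrow>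
      measure_pmf.expectation p (\<lambda>xs. sum_list (map f xs))
        \<le> (LINT a|\<xi>. f a) + w * measure \<xi> UNIV)"

lemma approximate_rounding_finite: "approximate_rounding R \<xi> F e p \<Longrightarrow> finite (set_pmf p)"
  by (simp add: approximate_rounding_def)

lemma approximate_rounding_covers:
  "approximate_rounding R \<xi> F e p \<Longrightarrow> xs \<in> set_pmf p \<Longrightarrow> y \<in> F \<Longrightarrow> \<exists>a\<in>set xs. (y, a) \<in> R"
  by (simp add: approximate_rounding_def)

lemma approximate_rounding_mean:
  assumes "approximate_rounding R \<xi> F e p" "continuous_on UNIV f" "\<And>a. 0 \<le> f a"
    and "\<And>a b. dist a b < e \<Longrightarrow> \<bar>f a - f b\<bar> \<le> w"
  shows "measure_pmf.expectation p (\<lambda>xs. sum_list (map f xs)) \<le> (LINT a|\<xi>. f a) + w * measure \<xi> UNIV"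
  using assms by (simp add: approximate_rounding_def)

lemma approximate_rounding_exists:
  fixes R :: "('y \<times> 'x::metric_space) set"
  assumes comp: "compact (UNIV :: 'x set)" and closed: "\<And>y. closed (R `` {y})"
    and ideal: "ideal_relation R" and cover: "fractional_cover R \<xi>"
    and F: "finite F" and e: "0 < e"
  shows "\<exists>p. approximate_rounding R \<xi> F e p"
proof -
  have \<xi>: "finite_measure \<xi>" "sets \<xi> = sets borel" "\<And>y. 1 \<le> emeasure \<xi> (R `` {y})"
    using cover by (auto simp: fractional_cover_def finite_borel_measures_def)
  obtain ys where ys: "set ys = F" using finite_list[OF F] by blast
  let ?B = "(\<lambda>y. R `` {y}) ` F"
  obtain k and x :: "nat \<Rightarrow> 'x" and z :: "nat \<Rightarrow> real"
    where z: "\<And>j. 0 \<le> z j" "\<And>j. k \<le> j \<Longrightarrow> z j = 0"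
      "\<And>B. B \<in> ?B \<Longrightarrow> (\<Sum>j<k. of_bool (x j \<in> B) * z j) = measure \<xi> B"
      "\<And>f w. continuous_on UNIV f \<Longrightarrow> (\<And>a b. dist a b < e \<Longrightarrow> \<bar>f a - f b\<bar> \<le> w) \<Longrightarrow>
        (\<Sum>j<k. z j * f (x j)) \<le> (LINT a|\<xi>. f a) + w * measure \<xi> UNIV"
  proof (rule finite_discretisation[OF comp \<xi>(1,2), of ?B e])
    show "finite ?B" using F by simp
    show "B \<in> sets borel" if "B \<in> ?B" for B using that closed by (auto intro: borel_closed)
  qed (use e in auto)
  have "z \<in> cover_polyhedron (length ys) k (incidence_matrix R ((!) ys) x)"
  proof -
    have "1 \<le> (\<Sum>j<k. incidence_matrix R ((!) ys) x i j * z j)" if "i < length ys" for i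
    proof -
      have "R `` {ys ! i} \<in> ?B" using that ys by auto
      from z(3)[OF this] have "(\<Sum>j<k. incidence_matrix R ((!) ys) x i j * z j) = measure \<xi> (R `` {ys ! i})"
        by (simp add: incidence_matrix_def of_bool_def)
      moreover have "1 \<le> measure \<xi> (R `` {ys ! i})"
        using \<xi>(3)[of "ys ! i"] by (simp add: finite_measure.emeasure_eq_measure[OF \<xi>(1)])
      ultimately show ?thesis by simp
    qed
    then show ?thesis using z by (simp add: cover_polyhedron_def)
  qed
  from ideal_relation_rounding[OF ideal this]
  obtain p :: "'x list pmf" where p: "finite (set_pmf p)"
    "\<And>xs i. xs \<in> set_pmf p \<Longrightarrow> i < length ys \<Longrightarrow> \<exists>a\<in>set xs. (ys ! i, a) \<in> R"
    "\<And>f. (\<And>a. 0 \<le> f a) \<Longrightarrow>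
       measure_pmf.expectation p (\<lambda>xs. sum_list (map f xs)) \<le> (\<Sum>j<k. z j * f (x j))"
    by blast
  have "\<exists>a\<in>set xs. (y, a) \<in> R" if "xs \<in> set_pmf p" "y \<in> F" for xs y
    using p(2)[OF that(1)] that(2) ys by (metis in_set_conv_nth)
  moreover have "measure_pmf.expectation p (\<lambda>xs. sum_list (map f xs)) \<le> (LINT a|\<xi>. f a) + w * measure \<xi> UNIV"
    if "continuous_on UNIV f" "\<forall>a. 0 \<le> f a" "\<forall>a b. dist a b < e \<longrightarrow> \<bar>f a - f b\<bar> \<le> w" for f w
    using p(3)[of f] z(4)[of f w] that by force
  ultimately have "approximate_rounding R \<xi> F e p"
    using p(1) by (simp add: approximate_rounding_def)
  then show ?thesis by blast
qed

section \<open>Coding finite lists by real numbers\<close>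

text \<open>
The digits are 0 and 1 to base 3, so the code determines the digits and close codes have a long common
initial segment. To base 2 this would fail, since two expansions may name the same number.
\<close>

definition ternary_code :: "(nat \<Rightarrow> bool) \<Rightarrow> real"
  where "ternary_code b = (\<Sum>k. of_bool (b k) * (1/3) ^ Suc k)"

lemma ternary_tail: "(\<Sum>k. (1/3 :: real) ^ Suc (k + n)) = (1/3) ^ n / 2"
  and ternary_tail_summable: "summable (\<lambda>k. (1/3 :: real) ^ Suc (k + n))"
proof -
  have "(\<lambda>k. (1/3) ^ Suc n * (1/3 :: real) ^ k) sums ((1/3) ^ Suc n * (1 / (1 - 1/3)))"
    by (intro sums_mult geometric_sums) simp
  then have "(\<lambda>k. (1/3 :: real) ^ Suc (k + n)) sums ((1/3) ^ n / 2)"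
    by (simp add: power_add algebra_simps)
  then show "(\<Sum>k. (1/3 :: real) ^ Suc (k + n)) = (1/3) ^ n / 2"
    and "summable (\<lambda>k. (1/3 :: real) ^ Suc (k + n))"
    by (auto simp: sums_iff)
qed

lemma ternary_bits_summable: "summable (\<lambda>k. of_bool (b k) * (1/3 :: real) ^ Suc (k + n))"
  by (rule summable_comparison_test'[OF ternary_tail_summable[of n], of 0]) auto

lemma ternary_bits_tail:
  "0 \<le> (\<Sum>k. of_bool (b k) * (1/3 :: real) ^ Suc (k + n))"
  "(\<Sum>k. of_bool (b k) * (1/3 :: real) ^ Suc (k + n)) \<le> (1/3) ^ n / 2"
proof -
  show "0 \<le> (\<Sum>k. of_bool (b k) * (1/3 :: real) ^ Suc (k + n))"
    by (intro suminf_nonneg ternary_bits_summable) auto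
  have "(\<Sum>k. of_bool (b k) * (1/3 :: real) ^ Suc (k + n)) \<le> (\<Sum>k. (1/3) ^ Suc (k + n))"
    by (intro suminf_le ternary_bits_summable ternary_tail_summable) auto
  then show "(\<Sum>k. of_bool (b k) * (1/3 :: real) ^ Suc (k + n)) \<le> (1/3) ^ n / 2"
    by (simp only: ternary_tail)
qed

lemma ternary_code_bounds: "0 \<le> ternary_code b" "ternary_code b \<le> 1/2"
  using ternary_bits_tail[where n = 0 and b = b] by (simp_all add: ternary_code_def)

text \<open>
At the first place where the digits differ the codes differ by \<open>(1/3)\<^bsup>n+1\<^esup>\<close>, and all later digits
together make up for at most half of this.
\<close>

lemma ternary_code_gap:
  assumes eq: "\<And>k. k < n \<Longrightarrow> b k = b' k" and n: "b n" "\<not> b' n"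
  shows "(1/3) ^ Suc n / 2 \<le> ternary_code b - ternary_code b'"
proof -
  have split: "ternary_code c =
      (\<Sum>k. of_bool (c (k + Suc n)) * (1/3) ^ Suc (k + Suc n))
      + (of_bool (c n) * (1/3) ^ Suc n + (\<Sum>k<n. of_bool (c k) * (1/3) ^ Suc k))" for c
    unfolding ternary_code_def
    using suminf_split_initial_segment[OF ternary_bits_summable[where n = 0 and b = c], of "Suc n"]
    by (simp add: algebra_simps)
  have "(\<Sum>k<n. of_bool (b k) * (1/3 :: real) ^ Suc k) = (\<Sum>k<n. of_bool (b' k) * (1/3) ^ Suc k)"
    using eq by (intro sum.cong) auto
  then show ?thesis
    using ternary_bits_tail(1)[where n = "Suc n" and b = "\<lambda>k. b (k + Suc n)"]
      ternary_bits_tail(2)[where n = "Suc n" and b = "\<lambda>k. b' (k + Suc n)"] n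
    unfolding split[of b] split[of b'] by simp
qed

lemma close_ternary_codes_agree:
  assumes close: "\<bar>ternary_code b - ternary_code b'\<bar> < (1/3) ^ Suc N / 2" and "k \<le> N"
  shows "b k = b' k"
proof (rule ccontr)
  assume "b k \<noteq> b' k"
  define n where "n = (LEAST k. b k \<noteq> b' k)"
  have n: "b n \<noteq> b' n" "n \<le> k" "\<And>k. k < n \<Longrightarrow> b k = b' k"
    unfolding n_def using \<open>b k \<noteq> b' k\<close>
    by (rule LeastI, rule Least_le, use not_less_Least[of _ "\<lambda>k. b k \<noteq> b' k"] in blast)
  have "(1/3) ^ Suc n / 2 \<le> \<bar>ternary_code b - ternary_code b'\<bar>"
  proof (cases "b n")
    case True
    with n(1) have "\<not> b' n" by simp
    from ternary_code_gap[of n b b', OF n(3) True this] show ?thesis by linarith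
  next
    case False
    with n(1) have "b' n" by simp
    from ternary_code_gap[of n b' b, OF n(3)[symmetric] this False] show ?thesis by linarith
  qed
  moreover have "(1/3 :: real) ^ Suc N \<le> (1/3) ^ Suc n"
    using n(2) \<open>k \<le> N\<close> by (intro power_decreasing) auto
  ultimately show False using close by linarith
qed

definition nearby_lists :: "real \<Rightarrow> 'x::metric_space list \<Rightarrow> 'x list \<Rightarrow> bool"
  where "nearby_lists e xs ys \<longleftrightarrow>
    length xs = length ys \<and> (\<forall>i<length xs. dist (xs ! i) (ys ! i) < e)"

lemma nearby_lists_triangle:
  "nearby_lists d xs ys \<Longrightarrow> nearby_lists e ys zs \<Longrightarrow> nearby_lists (d + e) xs zs"
  unfolding nearby_lists_def by (metis add_strict_mono dist_triangle le_less_trans)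

lemma nearby_lists_sym: "nearby_lists e xs ys \<Longrightarrow> nearby_lists e ys xs"
  by (auto simp: nearby_lists_def dist_commute)

text \<open>
The integer part of the code is the length of the list, and the ternary digits record, for each entry of
the list and each ball from a sequence of finer and finer finite nets, whether the entry lies in the ball.
The coding itself need not be continuous. What counts is that lists with close codes are close, because
their entries then lie in the same small balls.
\<close>

lemma real_coding_of_lists:
  assumes comp: "compact (UNIV :: 'x::metric_space set)"
  obtains code :: "'x::metric_space list \<Rightarrow> real"
  where "\<And>xs. length xs \<le> code xs" "\<And>xs. code xs \<le> length xs + 1/2"
    "\<And>L e. 0 < e \<Longrightarrow> \<exists>\<delta>>0. \<forall>xs ys. length xs \<le> L \<longrightarrow> \<bar>code xs - code ys\<bar> < \<delta> \<longrightarrow> nearby_lists e xs ys"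
proof -
  have "\<exists>T :: 'x list. \<forall>x. \<exists>i<length T. dist (T ! i) x < 1 / Suc n" for n
    using finite_net[OF comp, of "1 / Suc n"] by (metis of_nat_0_less_iff zero_less_Suc zero_less_divide_1_iff)
  then obtain T :: "nat \<Rightarrow> 'x list" where T: "\<And>n x. \<exists>i<length (T n). dist (T n ! i) x < 1 / Suc n"
    by metis
  define bit where "bit xs j n l \<longleftrightarrow> j < length xs \<and> dist (T n ! l) (xs ! j) < 1 / Suc n" for xs j n l
  define bits where "bits xs k = (case from_nat k of (j, n, l) \<Rightarrow> bit xs j n l)" for xs k
  define code where "code xs = length xs + ternary_code (bits xs)" for xs
  have len: "length xs = length ys" if "\<bar>code xs - code ys\<bar> < 1/2" for xs ys
  proof -
    have "\<bar>real (length xs) - real (length ys)\<bar> < 1"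
      using that ternary_code_bounds[of "bits xs"] ternary_code_bounds[of "bits ys"]
      unfolding code_def by linarith
    then show ?thesis by linarith
  qed
  have near: "\<exists>\<delta>>0. \<forall>xs ys. length xs \<le> L \<longrightarrow> \<bar>code xs - code ys\<bar> < \<delta> \<longrightarrow> nearby_lists e xs ys"
    if e: "0 < e" for L :: nat and e :: real
  proof -
    obtain n where n: "1 / Suc n < e / 2"
      using reals_Archimedean[of "e/2"] e by (auto simp: inverse_eq_divide)
    let ?I = "(\<lambda>(j, l). to_nat (j, n, l)) ` ({..<L} \<times> {..<length (T n)})"
    define N where "N = Max (insert 0 ?I)"
    have N: "to_nat (j, n, l) \<le> N" if "j < L" "l < length (T n)" for j l
      unfolding N_def using that by (intro Max_ge) auto
    define \<delta> where "\<delta> = (1/3 :: real) ^ Suc N / 2"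
    have \<delta>: "0 < \<delta>" "\<delta> \<le> 1/2" using power_le_one[of "1/3 :: real" "Suc N"] by (auto simp: \<delta>_def simp del: power_Suc)
    have "nearby_lists e xs ys" if L: "length xs \<le> L" and close: "\<bar>code xs - code ys\<bar> < \<delta>" for xs ys
    proof -
      have l: "length xs = length ys" using len close \<delta> by (meson less_le_trans)
      then have "\<bar>ternary_code (bits xs) - ternary_code (bits ys)\<bar> < (1/3) ^ Suc N / 2"
        using close by (simp add: code_def \<delta>_def)
      note agree = close_ternary_codes_agree[OF this]
      have "dist (xs ! j) (ys ! j) < e" if j: "j < length xs" for j
      proof -
        obtain i where i: "i < length (T n)" "dist (T n ! i) (xs ! j) < 1 / Suc n"
          using T by blast
        have "bits xs (to_nat (j, n, i)) = bits ys (to_nat (j, n, i))"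
          using agree N i(1) j L by simp
        then have "dist (T n ! i) (ys ! j) < 1 / Suc n"
          using i(2) j by (simp add: bits_def bit_def)
        then show ?thesis
          using i(2) n dist_triangle3[of "xs ! j" "ys ! j" "T n ! i"] by (simp add: dist_commute)
      qed
      then show ?thesis by (simp add: nearby_lists_def l)
    qed
    then show ?thesis using \<delta>(1) by blast
  qed
  show ?thesis
  proof (rule that[of code])
    show "length xs \<le> code xs" "code xs \<le> length xs + 1/2" for xs
      using ternary_code_bounds[of "bits xs"] by (simp_all add: code_def)
  qed (fact near)
qed

text \<open>
If codes of lists converge to \<open>t\<close>, then the lists eventually have the same length and are Cauchy in
each entry, hence converge by compactness of \<open>X\<close>. Their limit is \<open>dec t\<close>. Off the closed set \<open>K\<close> the
decoder takes a default value that keeps it measurable.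
\<close>

lemma real_coding_of_lists_decoder:
  assumes comp: "compact (UNIV :: 'x::metric_space set)"
  obtains code :: "'x::metric_space list \<Rightarrow> real" and dec :: "real \<Rightarrow> 'x list" and K
  where "\<And>xs. length xs \<le> code xs" "\<And>xs. code xs \<le> length xs + 1/2"
    "closed K" "\<And>xs. code xs \<in> K" "\<And>xs. dec (code xs) = xs"
    "\<And>t. t \<notin> K \<Longrightarrow> dec t = []"
    "\<And>t e. t \<in> K \<Longrightarrow> 0 < e \<Longrightarrow> \<exists>\<delta>>0. \<forall>t'\<in>K. \<bar>t' - t\<bar> < \<delta> \<longrightarrow> nearby_lists e (dec t) (dec t')"
proof -
  obtain code :: "'x list \<Rightarrow> real"
    where code: "\<And>xs. length xs \<le> code xs" "\<And>xs. code xs \<le> length xs + 1/2"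
      "\<And>L e. 0 < e \<Longrightarrow> \<exists>\<delta>>0. \<forall>xs ys. length xs \<le> L \<longrightarrow> \<bar>code xs - code ys\<bar> < \<delta> \<longrightarrow> nearby_lists e xs ys"
    using real_coding_of_lists[OF comp] by blast
  define K where "K = closure (range code)"
  have "\<forall>t\<in>K. \<exists>zs. \<forall>e>0. \<exists>\<delta>>0. \<forall>ys. \<bar>code ys - t\<bar> < \<delta> \<longrightarrow> nearby_lists e zs ys"
  proof
    fix t assume t: "t \<in> K"
    show "\<exists>zs. \<forall>e>0. \<exists>\<delta>>0. \<forall>ys. \<bar>code ys - t\<bar> < \<delta> \<longrightarrow> nearby_lists e zs ys"
  proof -
    obtain s where "\<And>n :: nat. s n \<in> range code" "s \<longlonglongrightarrow> t"
      using t unfolding K_def closure_sequential by blast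
    then have "\<forall>n. \<exists>xs. s n = code xs" by blast
    then obtain X where X: "\<And>n. s n = code (X n)" by metis
    have "s = (\<lambda>n. code (X n))" using X by (rule ext)
    then have lim: "(\<lambda>n. code (X n)) \<longlonglongrightarrow> t" using \<open>s \<longlonglongrightarrow> t\<close> by simp
    define L where "L = nat \<lceil>t + 1\<rceil>"
    have L: "length xs \<le> L" if "\<bar>code xs - t\<bar> < 1" for xs
      using code(1)[of xs] that unfolding L_def by linarith
    have close: "\<exists>\<delta>>0. \<forall>xs ys. \<bar>code xs - t\<bar> < \<delta> \<longrightarrow> \<bar>code ys - t\<bar> < \<delta> \<longrightarrow> nearby_lists e xs ys"
      if e: "0 < e" for e :: real
    proof -
      obtain \<delta> where d: "0 < \<delta>" "\<And>xs ys. length xs \<le> L \<Longrightarrow> \<bar>code xs - code ys\<bar> < \<delta> \<Longrightarrow> nearby_lists e xs ys"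
        using code(3)[OF e, of L] by blast
      have "nearby_lists e xs ys"
        if "\<bar>code xs - t\<bar> < min 1 (\<delta>/2)" "\<bar>code ys - t\<bar> < min 1 (\<delta>/2)" for xs ys
      proof -
        have "\<bar>code xs - code ys\<bar> < \<delta>" using that by linarith
        moreover have "length xs \<le> L" using that by (intro L) simp
        ultimately show ?thesis using d(2) by blast
      qed
      then show ?thesis using d(1) by (intro exI[of _ "min 1 (\<delta>/2)"]) auto
    qed
    have ev: "eventually (\<lambda>n. \<bar>code (X n) - t\<bar> < \<delta>) sequentially" if "0 < \<delta>" for \<delta>
      using tendstoD[OF lim that] by (simp add: dist_real_def)
    obtain \<delta>1 where d1: "0 < \<delta>1"
      "\<And>xs ys. \<bar>code xs - t\<bar> < \<delta>1 \<Longrightarrow> \<bar>code ys - t\<bar> < \<delta>1 \<Longrightarrow> nearby_lists 1 xs ys"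
      using close[of 1] by auto
    obtain n1 where n1: "\<And>n. n \<ge> n1 \<Longrightarrow> \<bar>code (X n) - t\<bar> < \<delta>1"
      using ev[OF d1(1)] by (auto simp: eventually_sequentially)
    define m where "m = length (X n1)"
    have len: "length (X n) = m" if "n \<ge> n1" for n
      using d1(2)[OF n1[OF that] n1[OF order_refl]] by (simp add: m_def nearby_lists_def)
    have "\<exists>z. (\<lambda>n. X n ! i) \<longlonglongrightarrow> z" if i: "i < m" for i
    proof -
      have "Cauchy (\<lambda>n. X n ! i)"
      proof (rule metric_CauchyI)
        fix e :: real assume "0 < e"
        then obtain \<delta> where d: "0 < \<delta>"
          "\<And>xs ys. \<bar>code xs - t\<bar> < \<delta> \<Longrightarrow> \<bar>code ys - t\<bar> < \<delta> \<Longrightarrow> nearby_lists e xs ys"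
          using close by blast
        obtain n2 where n2: "\<And>n. n \<ge> n2 \<Longrightarrow> \<bar>code (X n) - t\<bar> < \<delta>"
          using ev[OF d(1)] by (auto simp: eventually_sequentially)
        have "dist (X a ! i) (X b ! i) < e" if "a \<ge> max n1 n2" "b \<ge> max n1 n2" for a b
          using d(2)[of "X a" "X b"] n2[of a] n2[of b] that i len[of a] by (simp add: nearby_lists_def)
        then show "\<exists>M. \<forall>a\<ge>M. \<forall>b\<ge>M. dist (X a ! i) (X b ! i) < e" by blast
      qed
      then show ?thesis
        using compact_imp_complete[OF comp] by (auto simp: complete_def)
    qed
    then obtain z where z: "\<And>i. i < m \<Longrightarrow> (\<lambda>n. X n ! i) \<longlonglongrightarrow> z i" by metis
    define zs where "zs = map z [0..<m]"
    have "\<exists>\<delta>>0. \<forall>ys. \<bar>code ys - t\<bar> < \<delta> \<longrightarrow> nearby_lists e zs ys" if e: "0 < e" for e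
    proof -
      obtain \<delta> where d: "0 < \<delta>"
        "\<And>xs ys. \<bar>code xs - t\<bar> < \<delta> \<Longrightarrow> \<bar>code ys - t\<bar> < \<delta> \<Longrightarrow> nearby_lists (e/2) xs ys"
        using close[of "e/2"] e by auto
      have "nearby_lists e zs ys" if ys: "\<bar>code ys - t\<bar> < \<delta>" for ys
      proof -
        have e1: "eventually (\<lambda>n. n \<ge> n1 \<and> nearby_lists (e/2) (X n) ys) sequentially"
          using eventually_conj[OF eventually_ge_at_top[of n1] ev[OF d(1)]]
          by eventually_elim (use d(2) ys in auto)
        have "eventually (\<lambda>n. length (X n) = m \<and> nearby_lists (e/2) (X n) ys) sequentially"
          using e1 by eventually_elim (use len in auto)
        from eventually_happens'[OF sequentially_bot this]
        obtain n where "length (X n) = m" "nearby_lists (e/2) (X n) ys" by blast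
        then have "length ys = m" by (simp add: nearby_lists_def)
        moreover have "dist (z i) (ys ! i) < e" if i: "i < m" for i
        proof -
          have "(\<lambda>n. dist (X n ! i) (ys ! i)) \<longlonglongrightarrow> dist (z i) (ys ! i)"
            by (intro tendsto_dist z[OF i] tendsto_const)
          moreover have "eventually (\<lambda>n. dist (X n ! i) (ys ! i) \<le> e/2) sequentially"
            using e1 by eventually_elim (use i len in \<open>auto simp: nearby_lists_def less_imp_le\<close>)
          ultimately have "dist (z i) (ys ! i) \<le> e/2"
            by (rule tendsto_upperbound) simp
          then show ?thesis using e by simp
        qed
        ultimately show ?thesis by (simp add: nearby_lists_def zs_def)
      qed
      then show ?thesis using d(1) by blast
    qed
    then show ?thesis by blast
    qed
  qed
  from bchoice[OF this] obtain dec0 where dec0: "\<And>t e. t \<in> K \<Longrightarrow> 0 < e \<Longrightarrow>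
      \<exists>\<delta>>0. \<forall>ys. \<bar>code ys - t\<bar> < \<delta> \<longrightarrow> nearby_lists e (dec0 t) ys"
    by blast
  define dec where "dec t = (if t \<in> K then dec0 t else [])" for t
  have dec: "\<exists>\<delta>>0. \<forall>ys. \<bar>code ys - t\<bar> < \<delta> \<longrightarrow> nearby_lists e (dec t) ys" if "t \<in> K" "0 < e" for t e
    using dec0[OF that] that(1) by (simp add: dec_def)
  have K: "code xs \<in> K" for xs
    using closure_subset[of "range code"] by (auto simp: K_def)
  show ?thesis
  proof (rule that[of code K dec])
    show "closed K" by (simp add: K_def)
    show "dec (code xs) = xs" for xs
    proof -
      have near: "nearby_lists e (dec (code xs)) xs" if "0 < e" for e
        using dec[OF K that, of xs] by force
      have l: "length (dec (code xs)) = length xs"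
        using near[of 1] by (simp add: nearby_lists_def)
      moreover have "dec (code xs) ! i = xs ! i" if i: "i < length (dec (code xs))" for i
      proof (rule ccontr)
        assume "dec (code xs) ! i \<noteq> xs ! i"
        then have "0 < dist (dec (code xs) ! i) (xs ! i)" by simp
        from near[OF this] show False using i by (auto simp: nearby_lists_def)
      qed
      ultimately show ?thesis by (intro nth_equalityI) auto
    qed
    show "dec t = []" if "t \<notin> K" for t using that by (simp add: dec_def)
    show "\<exists>\<delta>>0. \<forall>t'\<in>K. \<bar>t' - t\<bar> < \<delta> \<longrightarrow> nearby_lists e (dec t) (dec t')"
      if t: "t \<in> K" and e: "0 < e" for t e
    proof -
      obtain \<delta> where d: "0 < \<delta>" "\<And>ys. \<bar>code ys - t\<bar> < \<delta> \<Longrightarrow> nearby_lists (e/2) (dec t) ys"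
        using dec[OF t, of "e/2"] e by auto
      have "nearby_lists e (dec t) (dec t')" if t': "t' \<in> K" "\<bar>t' - t\<bar> < \<delta>/2" for t'
      proof -
        obtain \<delta>' where d': "0 < \<delta>'" "\<And>ys. \<bar>code ys - t'\<bar> < \<delta>' \<Longrightarrow> nearby_lists (e/2) (dec t') ys"
          using dec[OF t'(1), of "e/2"] e by auto
        obtain ys where ys: "\<bar>code ys - t'\<bar> < min \<delta>' (\<delta>/2)"
        proof -
          have "0 < min \<delta>' (\<delta>/2)" using d d' by simp
          then have "\<exists>s\<in>range code. dist s t' < min \<delta>' (\<delta>/2)"
            using t'(1) closure_approachable[of t' "range code"] unfolding K_def by blast
          then show ?thesis using that by (auto simp: dist_real_def)
        qed
        then have "\<bar>code ys - t\<bar> < \<delta>" "\<bar>code ys - t'\<bar> < \<delta>'" using t'(2) by linarith+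
        then have "nearby_lists (e/2 + e/2) (dec t) (dec t')"
          using d(2) d'(2) nearby_lists_triangle nearby_lists_sym by blast
        then show ?thesis by simp
      qed
      then show ?thesis using d(1) by (intro exI[of _ "\<delta>/2"]) auto
    qed
  qed (fact code(1) code(2) K)+
qed

section \<open>Configurations and subsequential limits of their laws\<close>

text \<open>
The counting measure of the entries, as an image of the counting measure on the positions, so that
repeated entries count with multiplicity.
\<close>

definition config :: "'x::topological_space list \<Rightarrow> 'x measure"
  where "config xs = distr (count_space {..<length xs}) borel (\<lambda>i. xs ! i)"

lemma sets_config [simp]: "sets (config xs) = sets borel"
  by (simp add: config_def)

lemma emeasure_config:
  assumes "A \<in> sets borel"
  shows "emeasure (config xs) A = (\<Sum>i<length xs. indicator A (xs ! i))"
proof -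
  have "emeasure (config xs) A = of_nat (card ((\<lambda>i. xs ! i) -` A \<inter> {..<length xs}))"
    using assms by (simp add: config_def emeasure_distr emeasure_count_space)
  also have "\<dots> = (\<Sum>i<length xs. if xs ! i \<in> A then 1 else 0)"
    by (simp add: sum.If_cases vimage_def Int_commute)
  finally show ?thesis by (simp add: indicator_def of_bool_def)
qed

lemma integral_config:
  fixes f :: "'x::topological_space \<Rightarrow> real"
  assumes "f \<in> borel_measurable borel"
  shows "(LINT a|config xs. f a) = sum_list (map f xs)"
proof -
  have "(LINT a|config xs. f a) = (\<Sum>i<length xs. f (xs ! i))"
    unfolding config_def using assms
    by (subst integral_distr) (simp_all add: lebesgue_integral_count_space_finite)
  then show ?thesis by (simp add: sum_list_sum_nth atLeast0LessThan)
qed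

lemma configurations_eq_range_config: "configurations = range config"
proof (intro set_eqI iffI)
  fix \<eta> :: "'a measure" assume "\<eta> \<in> configurations"
  then obtain m :: nat and x where s: "sets \<eta> = sets borel"
    and e: "\<And>A. A \<in> sets borel \<Longrightarrow> emeasure \<eta> A = (\<Sum>i<m. emeasure (return borel (x i)) A)"
    unfolding configurations_def by blast
  have "\<eta> = config (map x [0..<m])"
    using s e by (intro measure_eqI) (simp_all add: emeasure_config)
  then show "\<eta> \<in> range config" by blast
next
  fix \<eta> :: "'a measure" assume "\<eta> \<in> range config"
  then obtain xs where \<eta>: "\<eta> = config xs" by blast
  then have "\<forall>A\<in>sets borel. emeasure \<eta> A = (\<Sum>i<length xs. emeasure (return borel (xs ! i)) A)"
    by (simp add: emeasure_config)
  then show "\<eta> \<in> configurations" unfolding configurations_def using \<eta> by auto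
qed

lemma borel_measurable_integral_configuration_space:
  fixes f :: "'x::topological_space \<Rightarrow> real"
  assumes f: "continuous_on UNIV f" "bounded (range f)"
  shows "(\<lambda>\<eta>. LINT a|\<eta>. f a) \<in> borel_measurable configuration_space"
proof (rule borel_measurableI)
  fix U :: "real set" assume U: "open U"
  have "openin weak_topology {\<mu> \<in> finite_borel_measures. (LINT a|\<mu>. f a) \<in> U}"
    unfolding weak_topology_def using f U by (intro topology_generated_by_Basis) blast
  then have "openin configuration_topology
      ({\<mu> \<in> finite_borel_measures. (LINT a|\<mu>. f a) \<in> U} \<inter> configurations)"
    unfolding configuration_topology_def openin_subtopology by blast
  also have "{\<mu> \<in> finite_borel_measures. (LINT a|\<mu>. f a) \<in> U} \<inter> configurations
      = (\<lambda>\<eta>. LINT a|\<eta>. f a) -` U \<inter> space configuration_space"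
    using configurations_subset by (auto simp: space_configuration_space)
  finally show "(\<lambda>\<eta>. LINT a|\<eta>. f a) -` U \<inter> space configuration_space \<in> sets configuration_space"
    by (auto simp: sets_configuration_space)
qed

lemma continuous_on_sum_list_decoded:
  fixes f :: "'x::metric_space \<Rightarrow> real" and dec :: "real \<Rightarrow> 'x list"
  assumes near: "\<And>t e. t \<in> K \<Longrightarrow> 0 < e \<Longrightarrow>
      \<exists>\<delta>>0. \<forall>t'\<in>K. \<bar>t' - t\<bar> < \<delta> \<longrightarrow> nearby_lists e (dec t) (dec t')"
    and f: "continuous_on UNIV f"
  shows "continuous_on K (\<lambda>t. sum_list (map f (dec t)))"
  unfolding continuous_on_def
proof
  fix t assume t: "t \<in> K"
  have ev: "eventually (\<lambda>t'. nearby_lists e (dec t) (dec t')) (at t within K)" if "0 < e" for e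
  proof -
    obtain \<delta> where "0 < \<delta>" "\<forall>t'\<in>K. \<bar>t' - t\<bar> < \<delta> \<longrightarrow> nearby_lists e (dec t) (dec t')"
      using near[OF t \<open>0 < e\<close>] by blast
    then show ?thesis
      by (auto simp: eventually_at dist_real_def)
  qed
  have nth: "((\<lambda>t'. dec t' ! i) \<longlongrightarrow> dec t ! i) (at t within K)" if i: "i < length (dec t)" for i
  proof (rule tendstoI)
    fix e :: real assume "0 < e"
    show "eventually (\<lambda>t'. dist (dec t' ! i) (dec t ! i) < e) (at t within K)"
      using ev[OF \<open>0 < e\<close>] by eventually_elim (use i in \<open>auto simp: nearby_lists_def dist_commute\<close>)
  qed
  have "((\<lambda>t'. \<Sum>i<length (dec t). f (dec t' ! i)) \<longlongrightarrow> (\<Sum>i<length (dec t). f (dec t ! i))) (at t within K)"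
    by (intro tendsto_sum continuous_on_tendsto_compose[OF f] nth) auto
  moreover have "eventually (\<lambda>t'. (\<Sum>i<length (dec t). f (dec t' ! i)) = sum_list (map f (dec t'))) (at t within K)"
    using ev[OF zero_less_one]
    by eventually_elim (simp add: nearby_lists_def sum_list_sum_nth atLeast0LessThan)
  ultimately have "((\<lambda>t'. sum_list (map f (dec t'))) \<longlongrightarrow> (\<Sum>i<length (dec t). f (dec t ! i))) (at t within K)"
    by (rule Lim_transform_eventually)
  then show "((\<lambda>t'. sum_list (map f (dec t'))) \<longlongrightarrow> sum_list (map f (dec t))) (at t within K)"
    by (simp add: sum_list_sum_nth atLeast0LessThan)
qed

text \<open>
On \<open>K\<close> the decoded configuration depends continuously on the code, because integrals of continuous
functions do and these define the weak topology. Hence preimages of open sets are Borel, although the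
weak topology is given by an uncountable subbase.
\<close>

lemma measurable_config_decoded:
  fixes dec :: "real \<Rightarrow> 'x::metric_space list"
  assumes K: "closed K" and off: "\<And>t. t \<notin> K \<Longrightarrow> dec t = []"
    and cont: "\<And>f :: 'x \<Rightarrow> real. continuous_on UNIV f \<Longrightarrow> continuous_on K (\<lambda>t. sum_list (map f (dec t)))"
  shows "(\<lambda>t. config (dec t)) \<in> borel \<rightarrow>\<^sub>M configuration_space"
proof (rule measurable_sigma_sets[OF sets_configuration_space])
  have range: "config xs \<in> configurations" "config xs \<in> finite_borel_measures" for xs :: "'x list"
    using configurations_subset by (auto simp: configurations_eq_range_config)
  show "{U. openin configuration_topology U} \<subseteq> Pow (configurations :: 'x measure set)"
    by (auto simp: configuration_topology_def openin_subtopology)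
  show "(\<lambda>t. config (dec t)) \<in> space borel \<rightarrow> configurations" using range by simp
  have weak: "continuous_map (top_of_set K) weak_topology (\<lambda>t. config (dec t))"
    unfolding weak_topology_def
  proof (rule continuous_on_generated_topo)
    fix W :: "'x measure set"
    assume "W \<in> {{\<mu> \<in> finite_borel_measures. (LINT x|\<mu>. f x) \<in> U} | (f :: 'x \<Rightarrow> real) U.
       continuous_on UNIV f \<and> bounded (range f) \<and> open U}"
    then obtain f :: "'x \<Rightarrow> real" and U where W: "W = {\<mu> \<in> finite_borel_measures. (LINT x|\<mu>. f x) \<in> U}"
      and f: "continuous_on UNIV f" and U: "open U" by blast
    have "(\<lambda>t. config (dec t)) -` W \<inter> topspace (top_of_set K) = K \<inter> (\<lambda>t. sum_list (map f (dec t))) -` U"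
      using range by (auto simp: W integral_config[OF borel_measurable_continuous_onI[OF f]])
    then show "openin (top_of_set K) ((\<lambda>t. config (dec t)) -` W \<inter> topspace (top_of_set K))"
      using continuous_openin_preimage_gen[OF cont[OF f] U] by simp
  next
    have "\<Union>{{\<mu> \<in> finite_borel_measures. (LINT x|\<mu>. f x) \<in> U} | (f :: 'x \<Rightarrow> real) U.
       continuous_on UNIV f \<and> bounded (range f) \<and> open U} = finite_borel_measures"
      using topspace_weak_topology[where 'x = 'x]
      unfolding weak_topology_def topology_generated_by_topspace .
    then show "(\<lambda>t. config (dec t)) ` topspace (top_of_set K) \<subseteq>
       \<Union>{{\<mu> \<in> finite_borel_measures. (LINT x|\<mu>. f x) \<in> U} | (f :: 'x \<Rightarrow> real) U.
       continuous_on UNIV f \<and> bounded (range f) \<and> open U}"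
      using range by auto
  qed
  show "(\<lambda>t. config (dec t)) -` W \<inter> space borel \<in> sets borel"
    if W: "W \<in> {U. openin configuration_topology U}" for W :: "'x measure set"
  proof -
    obtain T where T: "openin weak_topology T" "W = T \<inter> configurations"
      using W by (auto simp: configuration_topology_def openin_subtopology)
    have "openin (top_of_set K) {t \<in> K. config (dec t) \<in> T}"
      using openin_continuous_map_preimage[OF weak T(1)] by simp
    then obtain O' where O': "open O'" "{t \<in> K. config (dec t) \<in> T} = K \<inter> O'"
      by (auto simp: openin_open)
    have "(\<lambda>t. config (dec t)) -` W \<inter> space borel
        = (K \<inter> O') \<union> (if config [] \<in> T then - K else {})"
    proof (rule set_eqI)
      fix t
      have "t \<in> K \<Longrightarrow> t \<in> O' \<longleftrightarrow> config (dec t) \<in> T" using O'(2) by blast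
      then show "t \<in> (\<lambda>t. config (dec t)) -` W \<inter> space borel
          \<longleftrightarrow> t \<in> (K \<inter> O') \<union> (if config [] \<in> T then - K else {})"
        using off[of t] range by (cases "t \<in> K") (auto simp: T(2))
    qed
    also have "\<dots> \<in> sets borel" using K O'(1) by (auto intro: borel_open borel_closed)
    finally show ?thesis .
  qed
qed

text \<open>
Convergence of laws of lists to a law of configurations, tested on integrals of continuous functions
against the configuration. The truncation at \<open>M\<close> keeps the tested quantity bounded, as the number
of points need not be.
\<close>

definition laws_converge :: "(nat \<Rightarrow> 'x::topological_space list pmf) \<Rightarrow> 'x measure measure \<Rightarrow> bool"
  where "laws_converge p P \<longleftrightarrow>
    (\<forall>(f :: 'x \<Rightarrow> real) M. continuous_on UNIV f \<longrightarrow> (\<forall>a. 0 \<le> f a) \<longrightarrow> 0 \<le> M \<longrightarrow>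
      (\<lambda>n. measure_pmf.expectation (p n) (\<lambda>xs. min M (sum_list (map f xs))))
        \<longlonglongrightarrow> (LINT \<eta>|P. min M (LINT a|\<eta>. f a)))"

lemma laws_convergeD:
  fixes f :: "'x::topological_space \<Rightarrow> real"
  assumes "laws_converge p P" "continuous_on UNIV f" "\<And>a. 0 \<le> f a" "0 \<le> M"
  shows "(\<lambda>n. measure_pmf.expectation (p n) (\<lambda>xs. min M (sum_list (map f xs))))
    \<longlonglongrightarrow> (LINT \<eta>|P. min M (LINT a|\<eta>. f a))"
  using assms by (simp add: laws_converge_def)

text \<open>
Prokhorov's theorem for laws on configurations, by way of Helly's theorem for the coded laws \<open>\<mu> n\<close> on
the real line. Tightness comes from Markov's inequality for the length of the list. Since the coded laws
all live on the closed set \<open>K\<close>, so does their limit \<open>Q\<close>. A truncated integral is continuous only on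
\<open>K\<close> as a function of the code, so Tietze's theorem is needed to turn it into a test function on the line.
\<close>

lemma configuration_laws_subsequential_limit:
  fixes p :: "nat \<Rightarrow> 'x::metric_space list pmf"
  assumes comp: "compact (UNIV :: 'x set)" and fin: "\<And>n. finite (set_pmf (p n))"
    and mean: "\<And>n. measure_pmf.expectation (p n) (\<lambda>xs. real (length xs)) \<le> c"
  obtains r :: "nat \<Rightarrow> nat" and P :: "'x measure measure"
  where "strict_mono r" "prob_space P" "sets P = sets configuration_space"
    "laws_converge (\<lambda>n. p (r n)) P"
proof -
  obtain code :: "'x list \<Rightarrow> real" and dec :: "real \<Rightarrow> 'x list" and K
    where code: "\<And>xs. length xs \<le> code xs" "\<And>xs. code xs \<le> length xs + 1/2"
      and K: "closed K" "\<And>xs. code xs \<in> K" and dec: "\<And>xs. dec (code xs) = xs"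
      and off: "\<And>t. t \<notin> K \<Longrightarrow> dec t = []"
      and near: "\<And>t e. t \<in> K \<Longrightarrow> 0 < e \<Longrightarrow>
        \<exists>\<delta>>0. \<forall>t'\<in>K. \<bar>t' - t\<bar> < \<delta> \<longrightarrow> nearby_lists e (dec t) (dec t')"
    by (rule real_coding_of_lists_decoder[OF comp]) (rule that; assumption)
  have cont: "continuous_on K (\<lambda>t. sum_list (map f (dec t)))" if "continuous_on UNIV f" for f :: "'x \<Rightarrow> real"
    using continuous_on_sum_list_decoded[OF near that] .
  note config_meas = measurable_config_decoded[OF K(1) off cont]
  define \<mu> where "\<mu> n = distr (measure_pmf (p n)) borel code" for n
  have \<mu>: "real_distribution (\<mu> n)" for n
    unfolding \<mu>_def by (rule prob_space.real_distribution_distr[OF prob_space_measure_pmf]) simp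
  have \<mu>_int: "(LINT t|\<mu> n. g t) = measure_pmf.expectation (p n) (\<lambda>xs. g (code xs))"
    if "continuous_on UNIV g" for g :: "real \<Rightarrow> real" and n
    unfolding \<mu>_def using borel_measurable_continuous_onI[OF that] by (subst integral_distr) auto
  have c: "0 \<le> c"
    by (rule order_trans[OF Bochner_Integration.integral_nonneg mean[of 0]]) simp
  have "tight \<mu>"
    unfolding tight_def
  proof (intro conjI allI impI)
    fix \<epsilon> :: real assume \<epsilon>: "0 < \<epsilon>"
    \<comment> \<open>Markov's inequality bounds the probability of more than \<open>b\<close> points by \<open>c / b\<close>, which is
      less than \<open>\<epsilon>\<close>. The code exceeds the number of points by at most 1/2.\<close>
    define b where "b = (c + 1) / \<epsilon>"
    have b: "0 < b" using c \<epsilon> by (simp add: b_def)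
    have "1 - \<epsilon> < measure (\<mu> n) {-1 <.. b + 1/2}" for n
    proof -
      let ?E = "measure_pmf.expectation (p n)"
      have int: "integrable (measure_pmf (p n)) h" for h :: "'x list \<Rightarrow> real"
        by (rule integrable_measure_pmf_finite[OF fin])
      have indicator_comp: "(\<lambda>xs. indicator A (code xs) :: real) = indicator (code -` A)" for A
        by (auto simp: indicator_def)
      have "1 - c / b \<le> ?E (\<lambda>xs. 1 - real (length xs) / b)"
        using mean[of n] b int by (simp add: field_simps)
      also have "\<dots> \<le> ?E (\<lambda>xs. indicator {-1 <.. b + 1/2} (code xs))"
      proof (rule integral_mono[OF int int])
        fix xs
        show "1 - real (length xs) / b \<le> indicator {-1 <.. b + 1/2} (code xs)"
        proof (cases "code xs \<le> b + 1/2")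
          case True
          moreover have "-1 < code xs" using code(1)[of xs] by linarith
          ultimately show ?thesis using b by simp
        next
          case False
          then have "b \<le> length xs" using code(2)[of xs] by linarith
          then show ?thesis using b by (simp add: indicator_def field_simps)
        qed
      qed
      also have "\<dots> = measure (\<mu> n) {-1 <.. b + 1/2}"
        by (simp add: \<mu>_def measure_distr indicator_comp)
      moreover have "c / b < \<epsilon>" using c \<epsilon> by (simp add: b_def divide_less_eq)
      ultimately show ?thesis by linarith
    qed
    then show "\<exists>a b. a < b \<and> (\<forall>n. 1 - \<epsilon> < measure (\<mu> n) {a<..b})"
      using b by (intro exI[of _ "-1"] exI[of _ "b + 1/2"]) auto
  qed (fact \<mu>)
  from tight_imp_convergent_subsubsequence[OF this strict_mono_id]
  obtain r Q where r: "strict_mono (r :: nat \<Rightarrow> nat)" and Q: "real_distribution Q"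
    and conv: "weak_conv_m (\<lambda>n. \<mu> (r n)) Q"
    by (auto simp: comp_def)
  interpret Q: real_distribution Q by fact
  have lim: "(\<lambda>n. measure_pmf.expectation (p (r n)) (\<lambda>xs. g (code xs))) \<longlonglongrightarrow> (LINT t|Q. g t)"
    if g: "continuous_on UNIV g" "\<And>t. norm (g t) \<le> B" for g :: "real \<Rightarrow> real" and B
    using weak_conv_imp_integral_bdd_continuous_conv[OF \<mu> Q conv, of g B] g
    by (simp add: \<mu>_int continuous_on_eq_continuous_at)
  have AE_K: "AE t in Q. t \<in> K"
  proof -
    have ne: "K \<noteq> {}" using K(2) by blast
    \<comment> \<open>This function is continuous on the line and vanishes exactly on \<open>K\<close>, hence at all codes.\<close>
    let ?g = "\<lambda>t. min 1 (infdist t K)"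
    have g: "continuous_on UNIV ?g" by (intro continuous_intros)
    have "norm (?g t) \<le> 1" for t using infdist_nonneg[of t K] by (simp add: abs_le_iff min_le_iff_disj)
    from lim[of ?g 1, OF g this] have "(\<lambda>n. 0) \<longlonglongrightarrow> (LINT t|Q. ?g t)"
      using infdist_zero[OF K(2)] by simp
    then have "(LINT t|Q. ?g t) = 0" using LIMSEQ_unique tendsto_const by blast
    moreover have "integrable Q ?g"
      by (rule Q.integrable_const_bound[of _ 1])
        (use borel_measurable_continuous_onI[OF g] in \<open>auto simp: infdist_nonneg\<close>)
    ultimately have "AE t in Q. ?g t = 0"
      using integral_nonneg_eq_0_iff_AE[of Q ?g] by (simp add: infdist_nonneg)
    then show ?thesis
      by eventually_elim (use in_closed_iff_infdist_zero[OF K(1) ne] in \<open>auto simp: min_def split: if_splits\<close>)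
  qed
  let ?P = "distr Q configuration_space (\<lambda>t. config (dec t))"
  have meas_Q: "(\<lambda>t. config (dec t)) \<in> Q \<rightarrow>\<^sub>M configuration_space"
    using config_meas by (simp cong: measurable_cong_sets)
  show ?thesis
  proof (rule that[of r ?P])
    show "prob_space ?P" by (rule Q.prob_space_distr[OF meas_Q])
    show "laws_converge (\<lambda>n. p (r n)) ?P"
      unfolding laws_converge_def
    proof (intro allI impI)
      fix f :: "'x \<Rightarrow> real" and M :: real
      assume f: "continuous_on UNIV f" "\<forall>a. 0 \<le> f a" and M: "0 \<le> M"
      let ?h = "\<lambda>t. min M (sum_list (map f (dec t)))"
      have h: "continuous_on K ?h" by (intro continuous_intros cont[OF f(1)])
      have "0 \<le> sum_list (map f xs)" for xs by (rule sum_list_nonneg) (use f(2) in auto)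
      then have "norm (?h t) \<le> M" for t using M by simp
      then obtain g where g: "continuous_on UNIV g" "\<And>t. t \<in> K \<Longrightarrow> g t = ?h t" "\<And>t. norm (g t) \<le> M"
        using Tietze[OF h, of UNIV M] K(1) M by auto
      have f_bdd: "bounded (range f)"
        using compact_continuous_image[OF f(1) comp] by (rule compact_imp_bounded)
      have h_eq: "sum_list (map f (dec t)) = (LINT a|config (dec t). f a)" for t
        using integral_config[OF borel_measurable_continuous_onI[OF f(1)]] by simp
      have eval: "(\<lambda>\<eta>. min M (LINT a|\<eta>. f a)) \<in> borel_measurable configuration_space"
        using borel_measurable_integral_configuration_space[OF f(1) f_bdd] by simp
      have "(LINT t|Q. g t) = (LINT t|Q. ?h t)"
      proof (rule integral_cong_AE)
        show "g \<in> borel_measurable Q" using borel_measurable_continuous_onI[OF g(1)] by simp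
        show "?h \<in> borel_measurable Q"
          unfolding h_eq by (rule measurable_compose[OF meas_Q eval])
        show "AE t in Q. g t = ?h t" using AE_K by eventually_elim (rule g(2))
      qed
      also have "\<dots> = (LINT \<eta>|?P. min M (LINT a|\<eta>. f a))"
        unfolding h_eq by (rule integral_distr[OF meas_Q eval, symmetric])
      finally show "(\<lambda>n. measure_pmf.expectation (p (r n)) (\<lambda>xs. min M (sum_list (map f xs))))
          \<longlonglongrightarrow> (LINT \<eta>|?P. min M (LINT a|\<eta>. f a))"
        using lim[OF g(1,3)] g(2)[OF K(2)] by (simp add: dec)
    qed
  qed (simp_all add: r)
qed

section \<open>The intensity of the limit law\<close>

text \<open>
The functions are \<open>min 1 (k * infdist a (- U))\<close>. For \<open>U = UNIV\<close> the distance to the empty set is 0 by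
convention, which is why this case is separate.
\<close>

lemma open_indicator_continuous_limit:
  fixes U :: "'x::metric_space set"
  assumes U: "open U"
  obtains f :: "nat \<Rightarrow> 'x \<Rightarrow> real"
  where "\<And>k. continuous_on UNIV (f k)" "\<And>k a. 0 \<le> f k a" "\<And>k a. f k a \<le> 1"
    "\<And>k a. a \<notin> U \<Longrightarrow> f k a = 0" "\<And>a. a \<in> U \<Longrightarrow> eventually (\<lambda>k. f k a = 1) sequentially"
proof (cases "U = UNIV")
  case True
  then show ?thesis by (intro that[of "\<lambda>_ _. 1"]) auto
next
  case False
  let ?d = "\<lambda>a. infdist a (- U)"
  let ?f = "\<lambda>k a. min 1 (real k * ?d a)"
  show ?thesis
  proof (rule that[of ?f])
    show "continuous_on UNIV (?f k)" for k by (intro continuous_intros)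
    show "?f k a = 0" if "a \<notin> U" for k a using that by simp
    show "eventually (\<lambda>k. ?f k a = 1) sequentially" if a: "a \<in> U" for a
    proof -
      have "?d a \<noteq> 0" using in_closed_iff_infdist_zero[of "- U" a] U False a by auto
      then have d: "0 < ?d a" using infdist_nonneg[of a "- U"] by linarith
      obtain N :: nat where N: "1 / ?d a < N" using reals_Archimedean2 by blast
      have "?f k a = 1" if "N \<le> k" for k
      proof -
        have "1 / ?d a \<le> real k" using N that by linarith
        then have "1 \<le> real k * ?d a" using d by (simp add: divide_le_eq)
        then show ?thesis by simp
      qed
      then show ?thesis by (auto simp: eventually_sequentially)
    qed
  qed (auto simp: infdist_nonneg)
qed

text \<open>
The sets with this approximation property are closed under complements, as closed and open sets change
roles. They contain the open sets, which are increasing unions of closed sets because the space is metric.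
For a countable union the open neighbourhoods are chosen with geometrically decreasing errors, and a
finite part of the union of the closed sets suffices.
\<close>

lemma finite_borel_measure_closed_open_approximation:
  fixes \<xi> :: "'x::metric_space measure"
  assumes \<xi>: "finite_measure \<xi>" "sets \<xi> = sets borel" and A: "A \<in> sets borel" and "0 < e"
  shows "\<exists>F U. closed F \<and> open U \<and> F \<subseteq> A \<and> A \<subseteq> U \<and> measure \<xi> (U - F) < e"
proof -
  interpret finite_measure \<xi> by fact
  have [measurable_cong, simp]: "sets \<xi> = sets borel" by fact
  have "A \<in> sigma_sets UNIV {S. open S}" using A by (simp add: borel_def)
  then show ?thesis using \<open>0 < e\<close>
  proof (induction arbitrary: e rule: sigma_sets.induct)
    case (Basic U)
    then have U: "open U" by simp
    show ?case
    proof (cases "U = UNIV")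
      case True
      then show ?thesis using Basic by (intro exI[of _ UNIV]) auto
    next
      case False
      define F where "F n = {a. 1 / Suc n \<le> infdist a (- U)}" for n
      have F: "closed (F n)" for n
        unfolding F_def by (intro closed_Collect_le continuous_intros)
      have pos: "0 < infdist a (- U) \<longleftrightarrow> a \<in> U" for a
      proof -
        have "closed (- U)" "- U \<noteq> {}" using U False by auto
        from in_closed_iff_infdist_zero[OF this, of a] show ?thesis
          using infdist_nonneg[of a "- U"] by auto
      qed
      have sub: "F n \<subseteq> U" for n
      proof
        fix a assume "a \<in> F n"
        then have "1 / Suc n \<le> infdist a (- U)" by (simp add: F_def)
        moreover have "0 < 1 / real (Suc n)" by simp
        ultimately have "0 < infdist a (- U)" by linarith
        then show "a \<in> U" by (simp add: pos)
      qed
      have "(\<lambda>n. measure \<xi> (U - F n)) \<longlonglongrightarrow> measure \<xi> (\<Inter>n. U - F n)"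
      proof (rule finite_Lim_measure_decseq)
        show "range (\<lambda>n. U - F n) \<subseteq> sets \<xi>" using U F by (auto intro: borel_open borel_closed)
        have "F m \<subseteq> F n" if "m \<le> n" for m n
        proof -
          have "1 / real (Suc n) \<le> 1 / real (Suc m)" using that by (simp add: frac_le)
          then show ?thesis unfolding F_def by (blast intro: order_trans)
        qed
        then show "decseq (\<lambda>n. U - F n)" by (auto simp: decseq_def)
      qed
      moreover have "(\<Inter>n. U - F n) = {}"
      proof -
        have "\<exists>n. a \<in> F n" if "a \<in> U" for a
        proof -
          obtain n where "inverse (real (Suc n)) < infdist a (- U)"
            using reals_Archimedean[of "infdist a (- U)"] \<open>a \<in> U\<close> pos by blast
          then have "a \<in> F n" by (simp add: F_def inverse_eq_divide)
          then show ?thesis by blast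
        qed
        then show ?thesis by auto
      qed
      ultimately have "(\<lambda>n. measure \<xi> (U - F n)) \<longlonglongrightarrow> 0" by (simp only: measure_empty)
      then have "eventually (\<lambda>n. measure \<xi> (U - F n) < e) sequentially"
        using Basic by (intro order_tendstoD(2)) auto
      then obtain n where "measure \<xi> (U - F n) < e" by (auto simp: eventually_sequentially)
      then show ?thesis using F sub U by blast
    qed
  next
    case Empty
    then show ?case by (intro exI[of _ "{}"]) auto
  next
    case (Compl A)
    from Compl.IH[OF Compl.prems]
    obtain F U where FU: "closed F" "open U" "F \<subseteq> A" "A \<subseteq> U" "measure \<xi> (U - F) < e" by blast
    have "- F - (- U) = U - F" by auto
    then have "closed (- U)" "open (- F)" "- U \<subseteq> UNIV - A" "UNIV - A \<subseteq> - F"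
      "measure \<xi> (- F - (- U)) < e"
      using FU by auto
    then show ?case by blast
  next
    case (Union A)
    have "\<exists>F U. closed F \<and> open U \<and> F \<subseteq> A i \<and> A i \<subseteq> U \<and> measure \<xi> (U - F) < e / 2 * (1/2) ^ Suc i" for i
      using Union.prems by (intro Union.IH) simp
    then obtain F U where FU: "\<And>i. closed (F i)" "\<And>i. open (U i)" "\<And>i. F i \<subseteq> A i" "\<And>i. A i \<subseteq> U i"
      "\<And>i. measure \<xi> (U i - F i) < e / 2 * (1/2) ^ Suc i"
      by metis
    let ?V = "\<Union>i. U i"
    define G where "G n = (\<Union>i<n. F i)" for n
    have m: "U i \<in> sets \<xi>" "F i \<in> sets \<xi>" for i using FU(1,2) by auto
    have Gc: "closed (G n)" for n unfolding G_def using FU(1) by (intro closed_UN) auto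
    have half: "(\<lambda>i. e / 2 * (1/2 :: real) ^ Suc i) sums (e / 2)"
      using sums_mult[OF power_half_series, of "e/2"] by simp
    have summ: "summable (\<lambda>i. measure \<xi> (U i - F i))"
      by (rule summable_comparison_test'[OF sums_summable[OF half], of 0]) (use FU(5) in \<open>auto intro: less_imp_le\<close>)
    have "measure \<xi> (?V - (\<Union>i. F i)) \<le> measure \<xi> (\<Union>i. U i - F i)"
      using m by (intro finite_measure_mono) auto
    also have "\<dots> \<le> (\<Sum>i. measure \<xi> (U i - F i))"
      using m by (intro finite_measure_subadditive_countably summ) auto
    also have "\<dots> \<le> e / 2"
      using suminf_le[OF less_imp_le[OF FU(5)] summ sums_summable[OF half]] sums_unique[OF half] by simp
    finally have lt: "measure \<xi> (?V - (\<Union>i. F i)) < e" using Union.prems by linarith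
    have "(\<lambda>n. measure \<xi> (?V - G n)) \<longlonglongrightarrow> measure \<xi> (\<Inter>n. ?V - G n)"
    proof (rule finite_Lim_measure_decseq)
      have "?V - G n \<in> sets \<xi>" for n using m borel_closed[OF Gc[of n]] by auto
      then show "range (\<lambda>n. ?V - G n) \<subseteq> sets \<xi>" by blast
      have "G m \<subseteq> G n" if "m \<le> n" for m n using that unfolding G_def by (intro UN_mono) auto
      then show "decseq (\<lambda>n. ?V - G n)" unfolding decseq_def by blast
    qed
    also have "(\<Inter>n. ?V - G n) = ?V - (\<Union>i. F i)" by (auto simp: G_def)
    finally have "eventually (\<lambda>n. measure \<xi> (?V - G n) < e) sequentially"
      by (rule order_tendstoD(2)[OF _ lt])
    then obtain n where n: "measure \<xi> (?V - G n) < e" by (auto simp: eventually_sequentially)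
    have "G n \<subseteq> \<Union> (range A)" unfolding G_def using FU(3) by blast
    moreover have "\<Union> (range A) \<subseteq> ?V" using FU(4) by blast
    moreover have "open ?V" using FU(2) by auto
    ultimately show ?case using Gc n by (intro exI[of _ "G n"] exI[of _ ?V]) simp
  qed
qed

lemma finite_borel_measure_outer_regular:
  fixes \<xi> :: "'x::metric_space measure"
  assumes \<xi>: "finite_measure \<xi>" "sets \<xi> = sets borel" and A: "A \<in> sets borel" and "0 < e"
  obtains U where "open U" "A \<subseteq> U" "emeasure \<xi> U \<le> emeasure \<xi> A + ennreal e"
proof -
  interpret finite_measure \<xi> by fact
  obtain F U where FU: "closed F" "open U" "F \<subseteq> A" "A \<subseteq> U" "measure \<xi> (U - F) < e"
    using finite_borel_measure_closed_open_approximation[OF assms] by blast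
  have "measure \<xi> U \<le> measure \<xi> (A \<union> (U - F))"
    using FU A \<xi>(2) by (intro finite_measure_mono) auto
  also have "\<dots> \<le> measure \<xi> A + measure \<xi> (U - F)"
    using FU A \<xi>(2) by (intro measure_Un_le) auto
  finally have "measure \<xi> U \<le> measure \<xi> A + e" using FU(5) by linarith
  then have "ennreal (measure \<xi> U) \<le> ennreal (measure \<xi> A) + ennreal e"
    using \<open>0 < e\<close> by (simp flip: ennreal_plus)
  then show ?thesis using that FU by (simp add: emeasure_eq_measure)
qed

text \<open>
By uniform continuity the oscillation of \<open>f\<close> at the scale of the \<open>n\<close>-th approximate rounding tends
to 0, so the error term in its mean disappears in the limit.
\<close>

lemma limit_law_integrals_le:
  fixes p :: "nat \<Rightarrow> 'x::metric_space list pmf" and f :: "'x \<Rightarrow> real"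
  assumes comp: "compact (UNIV :: 'x set)"
    and p: "\<And>n. approximate_rounding R \<xi> (F n) (1 / Suc n) (p n)"
    and r: "strict_mono r" and lim: "laws_converge (\<lambda>n. p (r n)) P"
    and f: "continuous_on UNIV f" "\<And>a. 0 \<le> f a" and M: "0 \<le> M"
  shows "(LINT \<eta>|P. min M (LINT a|\<eta>. f a)) \<le> (LINT a|\<xi>. f a)"
proof (rule field_le_epsilon)
  fix \<epsilon> :: real assume "0 < \<epsilon>"
  define w where "w = \<epsilon> / (measure \<xi> UNIV + 1)"
  have m: "0 < measure \<xi> UNIV + 1" by (simp add: add_nonneg_pos)
  have w: "0 < w" using \<open>0 < \<epsilon>\<close> m by (simp add: w_def)
  have "w * measure \<xi> UNIV \<le> w * (measure \<xi> UNIV + 1)" using w by simp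
  also have "\<dots> = \<epsilon>" using m by (simp add: w_def)
  finally have w_le: "w * measure \<xi> UNIV \<le> \<epsilon>" .
  obtain \<delta> where \<delta>: "0 < \<delta>" "\<And>a b. dist a b < \<delta> \<Longrightarrow> dist (f a) (f b) < w"
    using compact_uniformly_continuous[OF f(1) comp, unfolded uniformly_continuous_on_def, rule_format, OF w]
    by blast
  obtain N where N: "1 / Suc N < \<delta>"
    using reals_Archimedean[OF \<delta>(1)] by (auto simp: inverse_eq_divide)
  have int: "integrable (measure_pmf (p n)) h" for n and h :: "'x list \<Rightarrow> real"
    by (rule integrable_measure_pmf_finite[OF approximate_rounding_finite[OF p]])
  have "measure_pmf.expectation (p (r n)) (\<lambda>xs. min M (sum_list (map f xs))) \<le> (LINT a|\<xi>. f a) + \<epsilon>"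
    if "N \<le> n" for n
  proof -
    have "N \<le> r n" using that seq_suble[OF r, of n] by linarith
    then have "1 / real (Suc (r n)) \<le> 1 / real (Suc N)" by (simp add: frac_le)
    then have scale: "1 / real (Suc (r n)) < \<delta>" using N by linarith
    have "measure_pmf.expectation (p (r n)) (\<lambda>xs. min M (sum_list (map f xs)))
        \<le> measure_pmf.expectation (p (r n)) (\<lambda>xs. sum_list (map f xs))"
      by (intro integral_mono int) simp
    also have "\<dots> \<le> (LINT a|\<xi>. f a) + w * measure \<xi> UNIV"
    proof (rule approximate_rounding_mean[OF p f])
      fix a b :: 'x assume "dist a b < 1 / real (Suc (r n))"
      then have "dist a b < \<delta>" using scale by linarith
      from \<delta>(2)[OF this] show "\<bar>f a - f b\<bar> \<le> w" by (simp add: dist_real_def)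
    qed
    finally show ?thesis using w_le by linarith
  qed
  then show "(LINT \<eta>|P. min M (LINT a|\<eta>. f a)) \<le> (LINT a|\<xi>. f a) + \<epsilon>"
    by (intro LIMSEQ_le_const2[OF laws_convergeD[OF lim f M]]) blast
qed

text \<open>
For an open set \<open>U\<close>, the number of points in \<open>U\<close> is the limit of truncated integrals of continuous
functions below the indicator of \<open>U\<close>, and Fatou's lemma gives the bound. A general Borel set is
enclosed in open sets of almost the same \<open>\<xi>\<close>-mass.
\<close>

lemma intensity_le_of_integrals_le:
  fixes \<xi> :: "'x::metric_space measure"
  assumes comp: "compact (UNIV :: 'x set)"
    and \<xi>: "finite_measure \<xi>" "sets \<xi> = sets borel"
    and P: "prob_space P" "sets P = sets configuration_space"
    and le: "\<And>(f :: 'x \<Rightarrow> real) M. continuous_on UNIV f \<Longrightarrow> (\<And>a. 0 \<le> f a) \<Longrightarrow> 0 \<le> M \<Longrightarrow>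
      (LINT \<eta>|P. min M (LINT a|\<eta>. f a)) \<le> (LINT a|\<xi>. f a)"
    and A: "A \<in> sets borel"
  shows "intensity P A \<le> emeasure \<xi> A"
proof -
  interpret \<xi>: finite_measure \<xi> by fact
  interpret P: prob_space P by fact
  have space: "space P = range config"
    using sets_eq_imp_space_eq[OF P(2)] by (simp add: space_configuration_space configurations_eq_range_config)
  have open_le: "intensity P U \<le> emeasure \<xi> U" if U: "open U" for U
  proof -
    obtain f :: "nat \<Rightarrow> 'x \<Rightarrow> real" where f: "\<And>k. continuous_on UNIV (f k)" "\<And>k a. 0 \<le> f k a"
      "\<And>k a. f k a \<le> 1" "\<And>k a. a \<notin> U \<Longrightarrow> f k a = 0"
      "\<And>a. a \<in> U \<Longrightarrow> eventually (\<lambda>k. f k a = 1) sequentially"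
      using open_indicator_continuous_limit[OF U] by metis
    let ?G = "\<lambda>k \<eta>. min (real k) (LINT a|\<eta>. f k a)"
    have G_config: "?G k (config xs) = min (real k) (sum_list (map (f k) xs))" for k xs
      by (simp add: integral_config[OF borel_measurable_continuous_onI[OF f(1)]])
    have G_meas: "?G k \<in> borel_measurable P" for k
    proof -
      have "bounded (range (f k))"
        using compact_continuous_image[OF f(1) comp] by (rule compact_imp_bounded)
      then show ?thesis
        using borel_measurable_integral_configuration_space[OF f(1)] P(2)
        by (simp cong: measurable_cong_sets)
    qed
    have G_nonneg: "0 \<le> ?G k \<eta>" for k \<eta>
      using f(2) by (simp add: Bochner_Integration.integral_nonneg)
    have G_lim: "(\<lambda>k. ennreal (?G k \<eta>)) \<longlonglongrightarrow> emeasure \<eta> U" if "\<eta> \<in> space P" for \<eta>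
    proof -
      obtain xs where xs: "\<eta> = config xs" using \<open>\<eta> \<in> space P\<close> space by blast
      have "eventually (\<lambda>k. f k a = indicator U a) sequentially" for a
        using f(4)[of a] f(5)[of a] by (cases "a \<in> U") auto
      then have "eventually (\<lambda>k. (\<forall>i\<in>{..<length xs}. f k (xs ! i) = indicator U (xs ! i)) \<and> length xs \<le> k) sequentially"
        by (intro eventually_conj eventually_ge_at_top eventually_ball_finite) auto
      then have "eventually (\<lambda>k. ennreal (?G k \<eta>) = emeasure \<eta> U) sequentially"
      proof eventually_elim
        case (elim k)
        have "sum_list (map (f k) xs) = (\<Sum>i<length xs. indicator U (xs ! i))"
          using elim by (simp add: sum_list_sum_nth atLeast0LessThan)
        moreover have "(\<Sum>i<length xs. indicator U (xs ! i)) \<le> (\<Sum>i<length xs. 1 :: real)"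
          by (intro sum_mono) (simp add: indicator_def)
        ultimately have "?G k \<eta> = (\<Sum>i<length xs. indicator U (xs ! i))"
          using elim unfolding xs G_config by simp
        moreover have "emeasure \<eta> U = (\<Sum>i<length xs. ennreal (indicator U (xs ! i)))"
          unfolding xs using U by (simp add: emeasure_config ennreal_indicator)
        ultimately show ?case by (simp add: sum_ennreal)
      qed
      then show ?thesis by (rule tendsto_eventually)
    qed
    have G_le: "(\<integral>\<^sup>+ \<eta>. ennreal (?G k \<eta>) \<partial>P) \<le> emeasure \<xi> U" for k
    proof -
      have "integrable P (?G k)"
        by (rule P.integrable_const_bound[of _ "real k"]) (use G_nonneg G_meas in auto)
      then have "(\<integral>\<^sup>+ \<eta>. ennreal (?G k \<eta>) \<partial>P) = ennreal (LINT \<eta>|P. ?G k \<eta>)"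
        using G_nonneg by (intro nn_integral_eq_integral) auto
      also have "\<dots> \<le> ennreal (LINT a|\<xi>. f k a)"
        using le[of "f k" "real k", OF f(1) f(2)] by (intro ennreal_leI) simp
      also have "(LINT a|\<xi>. f k a) \<le> (LINT a|\<xi>. indicator U a)"
      proof (rule integral_mono)
        show "integrable \<xi> (f k)"
          by (rule \<xi>.integrable_const_bound[of _ 1])
            (use f borel_measurable_continuous_onI[OF f(1)] \<xi>(2) in \<open>auto cong: measurable_cong_sets\<close>)
        show "integrable \<xi> (indicator U :: 'x \<Rightarrow> real)"
          using U \<xi>(2) by (intro integrable_real_indicator) (auto simp: less_top[symmetric])
        show "f k a \<le> indicator U a" for a
          using f(3)[of k a] f(4)[of a k] by (cases "a \<in> U") auto
      qed
      also have "\<dots> = measure \<xi> U"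
        using sets_eq_imp_space_eq[OF \<xi>(2)] by simp
      finally show ?thesis by (simp add: \<xi>.emeasure_eq_measure ennreal_leI)
    qed
    have "intensity P U = (\<integral>\<^sup>+ \<eta>. liminf (\<lambda>k. ennreal (?G k \<eta>)) \<partial>P)"
      unfolding intensity_def
      by (intro nn_integral_cong lim_imp_Liminf[symmetric] G_lim) auto
    also have "\<dots> \<le> liminf (\<lambda>k. \<integral>\<^sup>+ \<eta>. ennreal (?G k \<eta>) \<partial>P)"
      using G_meas by (intro nn_integral_liminf) auto
    also have "\<dots> \<le> liminf (\<lambda>k. emeasure \<xi> U)"
      using G_le by (intro Liminf_mono) auto
    also have "\<dots> = emeasure \<xi> U" by (simp add: Liminf_const)
    finally show ?thesis .
  qed
  show ?thesis
  proof (rule ennreal_le_epsilon)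
    fix e :: real assume "0 < e"
    obtain U where U: "open U" "A \<subseteq> U" "emeasure \<xi> U \<le> emeasure \<xi> A + ennreal e"
      using finite_borel_measure_outer_regular[OF \<xi> A \<open>0 < e\<close>] by blast
    have "intensity P A \<le> intensity P U"
      unfolding intensity_def
    proof (rule nn_integral_mono)
      fix \<eta> assume "\<eta> \<in> space P"
      then have "sets \<eta> = sets borel" using space by auto
      then show "emeasure \<eta> A \<le> emeasure \<eta> U" using U by (intro emeasure_mono) auto
    qed
    then show "intensity P A \<le> emeasure \<xi> A + ennreal e"
      using open_le[OF U(1)] U(3) by (meson order_trans)
  qed
qed

section \<open>Almost sure covering under the limit law\<close>

text \<open>
Unions of the first \<open>1 / Suc n\<close>-nets. The density of the union is stated with sequences, the form in which
the closedness of the relation is applied.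
\<close>

lemma increasing_finite_sets_with_dense_union:
  assumes comp: "compact (UNIV :: 'y::metric_space set)"
  obtains F :: "nat \<Rightarrow> 'y::metric_space set" where "\<And>n. finite (F n)" "mono F"
    "\<And>y. \<exists>d. d \<longlonglongrightarrow> y \<and> (\<forall>n::nat. d n \<in> (\<Union>n. F n))"
proof -
  have "\<exists>T :: 'y list. \<forall>y. \<exists>i<length T. dist (T ! i) y < 1 / Suc n" for n
    using finite_net[OF comp, of "1 / Suc n"] by fastforce
  then obtain T :: "nat \<Rightarrow> 'y list" where T: "\<And>n y. \<exists>i<length (T n). dist (T n ! i) y < 1 / Suc n"
    by metis
  define F where "F n = (\<Union>i\<le>n. set (T i))" for n
  show ?thesis
  proof (rule that[of F])
    show "finite (F n)" for n by (simp add: F_def)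
    show "mono F" unfolding F_def by (intro monoI UN_mono) auto
    show "\<exists>d. d \<longlonglongrightarrow> y \<and> (\<forall>n::nat. d n \<in> (\<Union>n. F n))" for y
    proof -
      have "\<exists>d. d \<in> (\<Union>n. F n) \<and> dist d y \<le> 1 / Suc n" for n
      proof -
        obtain i where i: "i < length (T n)" "dist (T n ! i) y < 1 / Suc n" using T by blast
        then have "T n ! i \<in> F n" unfolding F_def by (intro UN_I[of n]) auto
        then show ?thesis using i(2) by (intro exI[of _ "T n ! i"] conjI UN_I[of n]) auto
      qed
      then obtain d where d: "\<And>n. d n \<in> (\<Union>n. F n)" "\<And>n. dist (d n) y \<le> 1 / Suc n" by metis
      have "(\<lambda>n. 1 / real (Suc n)) \<longlonglongrightarrow> 0" by (rule LIMSEQ_Suc[OF lim_1_over_n])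
      then have "d \<longlonglongrightarrow> y"
        by (rule metric_tendsto_imp_tendsto) (use d(2) in \<open>simp add: dist_real_def\<close>)
      then show ?thesis using d(1) by blast
    qed
  qed
qed

text \<open>
Let \<open>g k\<close> be continuous functions that are 1 on \<open>C\<close> and, at each point off \<open>C\<close>, vanish for large \<open>k\<close>. A list that meets
\<open>C\<close> gives \<open>g k\<close> a sum of at least 1, so the truncation of the sum at 1 has expectation exactly 1. This passes to the
limit, and forces the integral of \<open>g k\<close> to be at least 1 almost surely, for all \<open>k\<close> at once. For a
configuration, which is finite, this means that one of its points lies in \<open>C\<close>.
\<close>

lemma limit_law_meets_closed_set:
  fixes p :: "nat \<Rightarrow> 'x::metric_space list pmf"
  assumes comp: "compact (UNIV :: 'x set)"
    and P: "prob_space P" "sets P = sets configuration_space"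
    and lim: "laws_converge p P"
    and C: "closed C"
    and hit: "eventually (\<lambda>n. \<forall>xs\<in>set_pmf (p n). \<exists>a\<in>set xs. a \<in> C) sequentially"
  shows "AE \<eta> in P. \<forall>xs. \<eta> = config xs \<longrightarrow> (\<exists>a\<in>set xs. a \<in> C)"
proof -
  interpret P: prob_space P by fact
  have "open (- C)" using C by (simp add: open_Compl)
  then obtain f :: "nat \<Rightarrow> 'x \<Rightarrow> real"
    where f: "\<And>k. continuous_on UNIV (f k)" "\<And>k a. 0 \<le> f k a" "\<And>k a. f k a \<le> 1"
      "\<And>k a. a \<notin> - C \<Longrightarrow> f k a = 0"
      "\<And>a. a \<in> - C \<Longrightarrow> eventually (\<lambda>k. f k a = 1) sequentially"
    by (rule open_indicator_continuous_limit) (rule that; assumption)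
  define g where "g k a = 1 - f k a" for k a
  have g: "continuous_on UNIV (g k)" "0 \<le> g k a" "a \<in> C \<Longrightarrow> g k a = 1" for k a
    using f(1)[of k] f(3)[of k a] f(4)[of a k] by (auto simp: g_def[abs_def] intro!: continuous_intros)
  have one: "AE \<eta> in P. 1 \<le> (LINT a|\<eta>. g k a)" for k
  proof -
    let ?h = "\<lambda>\<eta>. min 1 (LINT a|\<eta>. g k a)"
    have "eventually (\<lambda>n. measure_pmf.expectation (p n) (\<lambda>xs. min 1 (sum_list (map (g k) xs))) = 1) sequentially"
      using hit
    proof eventually_elim
      case (elim n)
      have "min 1 (sum_list (map (g k) xs)) = 1" if xs: "xs \<in> set_pmf (p n)" for xs
      proof -
        obtain a where a: "a \<in> set xs" "a \<in> C" using elim xs by blast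
        have "g k a \<le> sum_list (map (g k) xs)"
          using a(1) g(2) by (intro member_le_sum_list) auto
        then show ?thesis using g(3)[OF a(2)] by simp
      qed
      then have "measure_pmf.expectation (p n) (\<lambda>xs. min 1 (sum_list (map (g k) xs)))
          = measure_pmf.expectation (p n) (\<lambda>xs. 1)"
        by (intro integral_cong_AE) (auto simp: AE_measure_pmf_iff)
      then show ?case by simp
    qed
    then have "(\<lambda>n. measure_pmf.expectation (p n) (\<lambda>xs. min 1 (sum_list (map (g k) xs)))) \<longlonglongrightarrow> 1"
      by (rule tendsto_eventually)
    then have h1: "(LINT \<eta>|P. ?h \<eta>) = 1"
      using LIMSEQ_unique[OF laws_convergeD[OF lim, of "g k" 1, OF g(1) g(2)]] by simp
    have "bounded (range (g k))"
      using compact_continuous_image[OF g(1) comp] by (rule compact_imp_bounded)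
    then have meas: "?h \<in> borel_measurable P"
      using borel_measurable_integral_configuration_space[OF g(1)] P(2)
      by (simp cong: measurable_cong_sets)
    have "0 \<le> (LINT a|\<eta>. g k a)" for \<eta>
      using g(2) by (simp add: Bochner_Integration.integral_nonneg)
    then have h_int: "integrable P ?h"
      by (intro P.integrable_const_bound[of _ 1] meas) auto
    have "(LINT \<eta>|P. 1 - ?h \<eta>) = 0" using h1 h_int by (simp add: P.prob_space)
    then have "AE \<eta> in P. 1 - ?h \<eta> = 0"
      using integral_nonneg_eq_0_iff_AE[of P "\<lambda>\<eta>. 1 - ?h \<eta>"] h_int by simp
    then show ?thesis by eventually_elim linarith
  qed
  have "AE \<eta> in P. \<forall>k. 1 \<le> (LINT a|\<eta>. g k a)"
    using one by (simp add: AE_all_countable)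
  then show ?thesis
  proof eventually_elim
    case (elim \<eta>)
    have "\<exists>a\<in>set xs. a \<in> C" if xs: "\<eta> = config xs" for xs
    proof (rule ccontr)
      assume none: "\<not> (\<exists>a\<in>set xs. a \<in> C)"
      have "eventually (\<lambda>k. \<forall>a\<in>set xs. f k a = 1) sequentially"
        using none f(5) by (intro eventually_ball_finite) auto
      then obtain k where k: "\<forall>a\<in>set xs. f k a = 1"
        using eventually_happens'[OF sequentially_bot] by blast
      then have "sum_list (map (g k) xs) = sum_list (map (\<lambda>a. 0) xs)"
        by (intro arg_cong[of _ _ sum_list] map_cong) (simp_all add: g_def)
      moreover have "1 \<le> sum_list (map (g k) xs)"
        using elim integral_config[OF borel_measurable_continuous_onI[OF g(1)]] by (simp add: xs)
      ultimately show False by simp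
    qed
    then show ?case by blast
  qed
qed

lemma closed_section:
  fixes R :: "('y::topological_space \<times> 'x::topological_space) set"
  assumes "closed R"
  shows "closed (R `` {y})"
proof -
  have "R `` {y} = Pair y -` R" by auto
  then show ?thesis using assms by (auto intro!: closed_vimage continuous_intros)
qed

text \<open>
If the point \<open>y\<close> were not covered, then, as the list is finite and \<open>R\<close> is closed, no point near \<open>y\<close> would be.
\<close>

lemma covers_configI:
  fixes R :: "('y::metric_space \<times> 'x::metric_space) set"
  assumes R: "closed R" and d: "\<And>y :: 'y. \<exists>d. d \<longlonglongrightarrow> y \<and> (\<forall>n. d n \<in> D)"
    and hit: "\<And>y. y \<in> D \<Longrightarrow> \<exists>a\<in>set xs. (y, a) \<in> R"
  shows "covers R (config xs)"
  unfolding covers_def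
proof
  fix y :: 'y
  obtain d where d: "d \<longlonglongrightarrow> y" "\<And>n :: nat. d n \<in> D" using d by blast
  have "\<exists>a\<in>set xs. (y, a) \<in> R"
  proof (rule ccontr)
    assume "\<not> (\<exists>a\<in>set xs. (y, a) \<in> R)"
    then have "\<forall>a\<in>set xs. eventually (\<lambda>n. (d n, a) \<in> - R) sequentially"
      using R by (intro ballI topological_tendstoD[OF tendsto_Pair[OF d(1) tendsto_const]]) auto
    then have "eventually (\<lambda>n. \<forall>a\<in>set xs. (d n, a) \<in> - R) sequentially"
      by (simp add: eventually_ball_finite_distrib)
    then obtain n where "\<forall>a\<in>set xs. (d n, a) \<notin> R"
      by (auto simp: eventually_sequentially)
    then show False using hit[OF d(2)] by blast
  qed
  then obtain i where i: "i < length xs" "(y, xs ! i) \<in> R" by (auto simp: in_set_conv_nth)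
  have "emeasure (config xs) (R `` {y}) = (\<Sum>j<length xs. indicator (R `` {y}) (xs ! j))"
    by (intro emeasure_config borel_closed closed_section R)
  moreover have "indicator (R `` {y}) (xs ! i) \<le> (\<Sum>j<length xs. indicator (R `` {y}) (xs ! j) :: ennreal)"
    using i(1) by (intro member_le_sum) auto
  ultimately show "1 \<le> emeasure (config xs) (R `` {y})" using i(2) by simp
qed

section \<open>Fractional covers dominate random integral covers\<close>

theorem theorem2p16:
  fixes R :: "('y::metric_space \<times> 'x::metric_space) set"
    and \<xi> :: "'x measure"
  assumes "compact (UNIV :: 'y set)"
    and "compact (UNIV :: 'x set)"
    and "closed R"
    and "ideal_relation R"
    and "fractional_cover R \<xi>"
  shows "\<exists>P :: 'x measure measure.
           prob_space P \<and> sets P = sets configuration_space \<and>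
           (AE \<eta> in P. covers R \<eta>) \<and>
           (\<forall>A\<in>sets borel. intensity P A \<le> emeasure \<xi> A) \<and>
           (\<integral>\<^sup>+ \<eta>. emeasure \<eta> UNIV \<partial>P) \<le> emeasure \<xi> UNIV"
proof -
  have \<xi>: "finite_measure \<xi>" "sets \<xi> = sets borel"
    using assms(5) by (auto simp: fractional_cover_def finite_borel_measures_def)
  have closed: "closed (R `` {y})" for y by (rule closed_section[OF assms(3)])
  obtain F :: "nat \<Rightarrow> 'y set" where F: "\<And>n. finite (F n)" "mono F"
    and dense: "\<And>y. \<exists>d. d \<longlonglongrightarrow> y \<and> (\<forall>n::nat. d n \<in> (\<Union>n. F n))"
    by (rule increasing_finite_sets_with_dense_union[OF assms(1)]) (rule that; assumption)
  have "\<exists>p. approximate_rounding R \<xi> (F n) (1 / Suc n) p" for n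
    by (rule approximate_rounding_exists[OF assms(2) closed assms(4,5) F(1)]) simp
  then obtain p where p: "\<And>n. approximate_rounding R \<xi> (F n) (1 / Suc n) (p n)" by metis
  have len: "measure_pmf.expectation (p n) (\<lambda>xs. real (length xs)) \<le> measure \<xi> UNIV" for n
  proof -
    have "measure_pmf.expectation (p n) (\<lambda>xs. sum_list (map (\<lambda>_. 1) xs))
        \<le> (LINT a|\<xi>. 1) + 0 * measure \<xi> UNIV"
      by (rule approximate_rounding_mean[OF p]) auto
    then show ?thesis
      using sets_eq_imp_space_eq[OF \<xi>(2)] by (simp add: sum_list_triv)
  qed
  obtain r :: "nat \<Rightarrow> nat" and P :: "'x measure measure"
    where r: "strict_mono r" and P: "prob_space P" "sets P = sets configuration_space"
    and lim: "laws_converge (\<lambda>n. p (r n)) P"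
    by (rule configuration_laws_subsequential_limit[OF assms(2) approximate_rounding_finite[OF p] len])
  note le = limit_law_integrals_le[OF assms(2) p r lim]
  have intensity: "intensity P A \<le> emeasure \<xi> A" if "A \<in> sets borel" for A
    by (rule intensity_le_of_integrals_le[OF assms(2) \<xi> P le that])
  have "AE \<eta> in P. \<forall>xs. \<eta> = config xs \<longrightarrow> (\<exists>a\<in>set xs. a \<in> R `` {y})" if y: "y \<in> (\<Union>n. F n)" for y
  proof (rule limit_law_meets_closed_set[OF assms(2) P lim closed])
    obtain N where N: "y \<in> F N" using y by blast
    have "\<exists>a\<in>set xs. a \<in> R `` {y}" if n: "N \<le> n" and xs: "xs \<in> set_pmf (p (r n))" for n xs
    proof -
      have "N \<le> r n" using n seq_suble[OF r, of n] by linarith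
      then have "y \<in> F (r n)" using N monoD[OF F(2)] by blast
      from approximate_rounding_covers[OF p xs this] show ?thesis by blast
    qed
    then show "eventually (\<lambda>n. \<forall>xs\<in>set_pmf (p (r n)). \<exists>a\<in>set xs. a \<in> R `` {y}) sequentially"
      unfolding eventually_sequentially by blast
  qed
  moreover have "countable (\<Union>n. F n)"
    using F(1) by (intro countable_UN) (auto intro: countable_finite)
  ultimately have "AE \<eta> in P. \<forall>y\<in>(\<Union>n. F n). \<forall>xs. \<eta> = config xs \<longrightarrow> (\<exists>a\<in>set xs. a \<in> R `` {y})"
    by (subst AE_ball_countable) auto
  moreover have "AE \<eta> in P. \<eta> \<in> range config"
    using sets_eq_imp_space_eq[OF P(2)] AE_space[of P]
    by (simp add: space_configuration_space configurations_eq_range_config)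
  ultimately have "AE \<eta> in P. covers R \<eta>"
  proof eventually_elim
    case (elim \<eta>)
    then obtain xs where xs: "\<eta> = config xs" by blast
    then have "\<exists>a\<in>set xs. (y, a) \<in> R" if "y \<in> (\<Union>n. F n)" for y
      using elim(1) that by blast
    then show ?case unfolding xs by (rule covers_configI[OF assms(3) dense])
  qed
  moreover have "(\<integral>\<^sup>+ \<eta>. emeasure \<eta> UNIV \<partial>P) \<le> emeasure \<xi> UNIV"
    using intensity[of UNIV] by (simp add: intensity_def)
  ultimately show ?thesis using P intensity by blast
qed

end
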